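(* Let $\mathcal{H}$ be a separable infinite-dimensional Hilbert space and let $M$ be a locally compact Polish monoid. If $M$ is "good", then the space $\mathcal{C}_s(M)$ of contractive $C_0$-semigroups over $\mathcal{H}$ on $M$ is Polish (i.e. separable and completely metrisable) under the topology $k_{\mathrm{WOT}}$ of uniform weak operator convergence on compact subsets of $M$.
   Context: Hilbert spaces are complex. $\mathfrak{L}(\mathcal{H})$ denotes the bounded linear operators on $\mathcal{H}$ and $\mathcal{C}(\mathcal{H})\subseteq\mathfrak{L}(\mathcal{H})$ the contractions (operators of norm $\le 1$). WOT and SOT denote the weak and strong operator topologies. A topological monoid $(M,\cdot,1)$ (not necessarily commutative) is a monoid with a topology making multiplication continuous; a locally compact Polish monoid is one whose topology is locally compact and Polish. A semigroup over $\mathcal{H}$ on $M$ is a function $T:M\to\mathfrak{L}(\mathcal{H})$ with $T(1)=\mathbf{I}$ (the identity operator) and $T(st)=T(s)T(t)$ for all $s,t\in M$. It is contractive if $T(t)\in\mathcal{C}(\mathcal{H})$ for all $t$. $\mathcal{C}_s(M)$ (respectively $\mathcal{C}_w(M)$) denotes the set of all SOT-continuous (respectively WOT-continuous) contractive semigroups over $\mathcal{H}$ on $M$. The elements of $\mathcal{C}_s(M)$ are what is called contractive $C_0$-semigroups over $\mathcal{H}$ on $M$. The monoid $M$ is called "good" if $\mathcal{C}_w(M)=\mathcal{C}_s(M)$, i.e. every WOT-continuous contractive semigroup over $\mathcal{H}$ on $M$ is SOT-continuous. The topology $k_{\mathrm{WOT}}$ is determined by the convergence condition for nets: $T_i\to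 T$ iff for all $\xi,\eta\in\mathcal{H}$ and all compact $K\subseteq M$, $\sup_{t\in K}|\langle (T_i(t)-T(t))\xi,\eta\rangle|\to 0$. *)

theory Defs
  imports "HOL-Analysis.Analysis"
begin

text \<open>
  Complex Hilbert spaces. The class contains the underlying real Hilbert space, whose inner
  product is the real part of the complex one, so that \<open>norm x = sqrt (Re (cinner x x))\<close>.
  The complex inner product is linear in its first argument.
\<close>

class complex_hilbert = real_inner + complete_space +
  fixes scaleC :: "complex \<Rightarrow> 'a \<Rightarrow> 'a" (infixr "*\<^sub>C" 75)
    and cinner :: "'a \<Rightarrow> 'a \<Rightarrow> complex"
  assumes scaleC_add_right: "a *\<^sub>C (x + y) = a *\<^sub>C x + a *\<^sub>C y"
    and scaleC_add_left: "(a + b) *\<^sub>C x = a *\<^sub>C x + b *\<^sub>C x"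
    and scaleC_scaleC: "a *\<^sub>C b *\<^sub>C x = (a * b) *\<^sub>C x"
    and scaleC_of_real: "complex_of_real r *\<^sub>C x = r *\<^sub>R x"
    and cinner_commute: "cinner x y = cnj (cinner y x)"
    and cinner_add_left: "cinner (x + y) z = cinner x z + cinner y z"
    and cinner_scaleC_left: "cinner (a *\<^sub>C x) y = a * cinner x y"
    and Re_cinner: "Re (cinner x y) = inner x y"

global_interpretation complex_vector:
  vector_space "scaleC :: complex \<Rightarrow> 'a \<Rightarrow> 'a::complex_hilbert"
  defines cspan = complex_vector.span
proof
  show "1 *\<^sub>C x = x" for x :: 'a
    using scaleC_of_real [of 1 x] by simp
qed (fact scaleC_add_right scaleC_add_left scaleC_scaleC)+

definition infinite_dimensional :: "'h::complex_hilbert itself \<Rightarrow> bool"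
  where "infinite_dimensional _ \<longleftrightarrow> \<not> (\<exists>B::'h set. finite B \<and> cspan B = UNIV)"

text \<open>Library elements of \<open>'h \<Rightarrow>\<^sub>L 'h\<close> are only real-linear, hence the restriction.\<close>

definition bounded_operators :: "('h::complex_hilbert \<Rightarrow>\<^sub>L 'h) set"
  where "bounded_operators = {A :: 'h \<Rightarrow>\<^sub>L 'h. \<forall>c x. A (c *\<^sub>C x) = c *\<^sub>C A x}"

definition contractions :: "('h::complex_hilbert \<Rightarrow>\<^sub>L 'h) set"
  where "contractions = {A \<in> bounded_operators. norm A \<le> 1}"

text \<open>The counterpart of \<^const>\<open>strong_operator_topology\<close>: the initial topology of
  the maps \<open>A \<mapsto> cinner (A \<xi>) \<eta>\<close>.\<close>

definition weak_operator_topology :: "('h::complex_hilbert \<Rightarrow>\<^sub>L 'h) topology"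
  where "weak_operator_topology = pullback_topology UNIV (\<lambda>A (\<xi>, \<eta>). cinner (blinfun_apply A \<xi>) \<eta>) euclidean"

definition operator_semigroup :: "('m::monoid_mult \<Rightarrow> 'h::complex_hilbert \<Rightarrow>\<^sub>L 'h) \<Rightarrow> bool"
  where "operator_semigroup T \<longleftrightarrow> range T \<subseteq> bounded_operators \<and>
    T 1 = id_blinfun \<and> (\<forall>s t. T (s * t) = T s o\<^sub>L T t)"

definition contractive_semigroup :: "('m::monoid_mult \<Rightarrow> 'h::complex_hilbert \<Rightarrow>\<^sub>L 'h) \<Rightarrow> bool"
  where "contractive_semigroup T \<longleftrightarrow> operator_semigroup T \<and> range T \<subseteq> contractions"

definition C_s :: "('m::topological_monoid_mult \<Rightarrow> 'h::complex_hilbert \<Rightarrow>\<^sub>L 'h) set"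
  where "C_s = {T. contractive_semigroup T \<and> continuous_map euclidean strong_operator_topology T}"

definition C_w :: "('m::topological_monoid_mult \<Rightarrow> 'h::complex_hilbert \<Rightarrow>\<^sub>L 'h) set"
  where "C_w = {T. contractive_semigroup T \<and> continuous_map euclidean weak_operator_topology T}"

definition good_monoid :: "'m::topological_monoid_mult itself \<Rightarrow> 'h::complex_hilbert itself \<Rightarrow> bool"
  where "good_monoid _ _ \<longleftrightarrow> C_w = (C_s :: ('m \<Rightarrow> 'h \<Rightarrow>\<^sub>L 'h) set)"

definition polish_topology :: "'a topology \<Rightarrow> bool"
  where "polish_topology X \<longleftrightarrow> separable_space X \<and> completely_metrizable_space X"

text \<open>The supremum is taken in \<^typ>\<open>ennreal\<close>, so that it is meaningful for arbitrary
  functions and is \<open>0\<close> over the empty set.\<close>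

definition weak_sup_dist ::
    "'m set \<Rightarrow> 'h \<Rightarrow> 'h \<Rightarrow> ('m \<Rightarrow> 'h::complex_hilbert \<Rightarrow>\<^sub>L 'h) \<Rightarrow> ('m \<Rightarrow> 'h \<Rightarrow>\<^sub>L 'h) \<Rightarrow> ennreal"
  where "weak_sup_dist K \<xi> \<eta> S T = (SUP t\<in>K. ennreal (cmod (cinner ((S t - T t) \<xi>) \<eta>)))"

definition k_WOT :: "('m::topological_space \<Rightarrow> 'h::complex_hilbert \<Rightarrow>\<^sub>L 'h) topology"
  where "k_WOT = topology_generated_by
    {{S. weak_sup_dist K \<xi> \<eta> S T < e} | K \<xi> \<eta> T e. compact K \<and> 0 < e}"

text \<open>Continuity into the weak operator topology and convergence in \<^const>\<open>k_WOT\<close> are the expected ones.\<close>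

lemma topspace_weak_operator_topology [simp]: "topspace weak_operator_topology = UNIV"
  by (simp add: weak_operator_topology_def topspace_pullback_topology)

lemma continuous_map_weak_operator_topology_iff:
  fixes f :: "'a \<Rightarrow> 'h::complex_hilbert \<Rightarrow>\<^sub>L 'h"
  shows "continuous_map X weak_operator_topology f \<longleftrightarrow>
    (\<forall>\<xi> \<eta>. continuous_map X euclidean (\<lambda>t. cinner (f t \<xi>) \<eta>))"
proof -
  let ?g = "\<lambda>A::'h \<Rightarrow>\<^sub>L 'h. \<lambda>(\<xi>, \<eta>). cinner (blinfun_apply A \<xi>) \<eta>"
  have "continuous_map weak_operator_topology euclidean ?g"
    using continuous_map_pullback [OF continuous_map_id, of UNIV ?g]
    by (simp add: weak_operator_topology_def)
  then have "continuous_map X weak_operator_topology f \<longleftrightarrow> continuous_map X euclidean (?g \<circ> f)"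
    unfolding weak_operator_topology_def
    by (auto intro: continuous_map_compose continuous_map_pullback')
  also have "\<dots> \<longleftrightarrow> (\<forall>p. continuous_map X euclidean
      (\<lambda>t. (?g \<circ> f) t p))"
    by (simp add: euclidean_product_topology [symmetric] continuous_map_componentwise_UNIV)
  finally show ?thesis
    by simp
qed

lemma weak_sup_dist_triangle:
  "weak_sup_dist K \<xi> \<eta> R T \<le> weak_sup_dist K \<xi> \<eta> R S + weak_sup_dist K \<xi> \<eta> S T"
  unfolding weak_sup_dist_def
proof (rule SUP_least)
  fix t assume t: "t \<in> K"
  have eq: "cinner ((R t - T t) \<xi>) \<eta> = cinner ((R t - S t) \<xi>) \<eta> + cinner ((S t - T t) \<xi>) \<eta>"
    by (simp add: cinner_add_left [symmetric] blinfun.diff_left)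
  have "ennreal (cmod (cinner ((R t - T t) \<xi>) \<eta>))
      \<le> ennreal (cmod (cinner ((R t - S t) \<xi>) \<eta>)) + ennreal (cmod (cinner ((S t - T t) \<xi>) \<eta>))"
    unfolding eq by (simp add: norm_triangle_ineq flip: ennreal_plus)
  also have "\<dots> \<le> (SUP t\<in>K. ennreal (cmod (cinner ((R t - S t) \<xi>) \<eta>)))
      + (SUP t\<in>K. ennreal (cmod (cinner ((S t - T t) \<xi>) \<eta>)))"
    using t by (intro add_mono SUP_upper)
  finally show "ennreal (cmod (cinner ((R t - T t) \<xi>) \<eta>)) \<le> \<dots>" .
qed

lemma weak_sup_dist_refl [simp]: "weak_sup_dist K \<xi> \<eta> T T = 0"
proof -
  have "cinner 0 x = 0" for x :: 'b
    using cinner_add_left [of 0 0 x] by simp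
  then show ?thesis
    by (simp add: weak_sup_dist_def flip: bot_ennreal)
qed

lemma topspace_k_WOT [simp]: "topspace k_WOT = UNIV"
proof -
  have "T \<in> topspace k_WOT" for T :: "'a \<Rightarrow> 'b \<Rightarrow>\<^sub>L 'b"
    unfolding k_WOT_def topology_generated_by_topspace
    by (rule UnionI [of "{S. weak_sup_dist {} 0 0 S T < 1}"])
      (simp, intro CollectI exI conjI, rule refl, auto)
  then show ?thesis by auto
qed

lemma limitin_k_WOT_iff:
  "limitin k_WOT (f :: 'i \<Rightarrow> 'm::topological_space \<Rightarrow> 'h::complex_hilbert \<Rightarrow>\<^sub>L 'h) T F \<longleftrightarrow>
    (\<forall>K \<xi> \<eta>. compact K \<longrightarrow> ((\<lambda>i. weak_sup_dist K \<xi> \<eta> (f i) T) \<longlongrightarrow> 0) F)"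
    (is "?lhs \<longleftrightarrow> ?rhs")
proof
  assume lim: ?lhs
  show ?rhs
  proof (intro allI impI)
    fix K :: "'m set" and \<xi> \<eta> :: 'h
    assume K: "compact K"
    show "((\<lambda>i. weak_sup_dist K \<xi> \<eta> (f i) T) \<longlongrightarrow> 0) F"
      unfolding order_tendsto_iff
    proof (intro conjI allI impI)
      fix e :: ennreal
      assume "0 < e"
      then have "openin k_WOT {S. weak_sup_dist K \<xi> \<eta> S T < e}"
        unfolding k_WOT_def using K by (intro topology_generated_by_Basis) blast
      with lim \<open>0 < e\<close> show "\<forall>\<^sub>F i in F. weak_sup_dist K \<xi> \<eta> (f i) T < e"
        unfolding limitin_def by fastforce
    qed auto
  qed
next
  assume rhs: ?rhs
  have "\<forall>\<^sub>F i in F. f i \<in> U" if "openin k_WOT U" and "T \<in> U" for U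
  proof -
    have "generate_topology_on
        {{S. weak_sup_dist K \<xi> \<eta> S T < e} | K \<xi> \<eta> T e. compact K \<and> 0 < e} U"
      using that unfolding k_WOT_def by (simp add: openin_topology_generated_by_iff)
    then show ?thesis
      using \<open>T \<in> U\<close>
    proof (induction rule: generate_topology_on.induct)
      case (Int A B)
      then show ?case by (simp add: eventually_conj_iff)
    next
      case (UN \<U>)
      then obtain A where A: "A \<in> \<U>" "T \<in> A" by auto
      with UN.IH have "\<forall>\<^sub>F i in F. f i \<in> A" by blast
      with A show ?case by (auto elim: eventually_mono)
    next
      case (Basis V)
      then obtain K \<xi> \<eta> S e where V: "V = {R. weak_sup_dist K \<xi> \<eta> R S < e}" and K: "compact K"
        by blast
      let ?r = "weak_sup_dist K \<xi> \<eta> T S"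
      have "?r < e"
        using Basis V by simp
      then have "0 < e - ?r"
        by (simp add: diff_gt_0_iff_gt_ennreal)
      moreover have "((\<lambda>i. weak_sup_dist K \<xi> \<eta> (f i) T) \<longlongrightarrow> 0) F"
        using rhs K by blast
      ultimately have "\<forall>\<^sub>F i in F. weak_sup_dist K \<xi> \<eta> (f i) T < e - ?r"
        by (simp add: order_tendsto_iff)
      then show ?case
      proof (rule eventually_mono)
        fix i
        assume "weak_sup_dist K \<xi> \<eta> (f i) T < e - ?r"
        then have "weak_sup_dist K \<xi> \<eta> (f i) T + ?r < e"
          by (simp add: less_diff_eq_ennreal order.strict_trans2 [OF \<open>?r < e\<close>])
        then show "f i \<in> V"
          unfolding V using weak_sup_dist_triangle [of K \<xi> \<eta> "f i" S T] by simp
      qed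
    qed simp
  qed
  then show ?lhs
    by (simp add: limitin_def)
qed

end

theory Submission
  imports Defs
begin

text \<open>The topology \<^const>\<open>k_WOT\<close> makes the space of all weakly continuous maps from the monoid into
  the contractions Polish, and inside that space the semigroups form a \<open>G\<^sub>\<delta>\<close> set, which is
  therefore Polish too. Goodness of the monoid enters only at the end, where it identifies the
  weakly continuous semigroups with the strongly continuous ones.

  For the first half, choose a dense sequence \<open>d\<close> in the Hilbert space and bump functions \<open>\<phi> n\<close>
  with compact supports on the monoid such that the sets where \<open>\<phi> n\<close> exceeds \<open>1/2\<close> cover it
  (\<open>bump_functions\<close>). A map \<open>T\<close> is encoded by the countably many bounded continuous functions
  \<open>\<phi> n t * inner (T t (d i)) (d j)\<close>. Uniform weak convergence on compact sets is convergence of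
  every one of these functions in the sup metric (\<open>homeomorphic_space_encode\<close>), and the encodings
  form a closed set, because a pointwise weak limit of contractions is a contraction by the Riesz
  representation theorem (\<open>limit_of_encodings\<close>). Second countability holds since the functions
  on a second countable space that are supported on a fixed compact set form a separable set
  (\<open>separable_bcontfun_supported_on_compact\<close>).

  For the second half, the difficulty is that the product \<open>T s o\<^sub>L T t\<close> need not depend
  continuously on \<open>T\<close>, so that the semigroup law need not define a closed set. Its matrix
  coefficients are nevertheless limits of sequences of continuous functions of \<open>T\<close>, and the zero set
  of such a limit is a \<open>G\<^sub>\<delta>\<close> set (\<open>gdelta_in_zeros_of_pointwise_limit\<close>). To see this, write the
  coefficient as the inner product of \<open>T t x\<close> with the image of \<open>y\<close> under the adjoint of \<open>T s\<close>,
  express it through norms by polarization, and approximate the norm of a vector by the maximum of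
  finitely many of its inner products with unit vectors (\<open>gdelta_in_composition\<close>). Countably many
  times suffice, because both sides of the law are weakly continuous in each variable
  (\<open>composition_on_dense_subset\<close>).\<close>

section \<open>Hilbert space preliminaries\<close>

text \<open>Complex matrix coefficients are controlled by real ones, so that from here on the
  real inner product can be used throughout.\<close>

lemma cinner_eq_Complex_inner:
  "cinner x y = Complex (inner x y) (inner x (\<i> *\<^sub>C y))"
proof (rule complex_eqI)
  have "cinner x (\<i> *\<^sub>C y) = - \<i> * cinner x y"
    by (metis cinner_commute cinner_scaleC_left complex_cnj_mult complex_cnj_i)
  then have "inner x (\<i> *\<^sub>C y) = Im (cinner x y)"
    by (simp flip: Re_cinner)
  then show "Im (cinner x y) = Im (Complex (inner x y) (inner x (\<i> *\<^sub>C y)))"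
    by simp
qed (simp add: Re_cinner)

lemma inner_scaleC_left: "inner (c *\<^sub>C x) y = inner x (cnj c *\<^sub>C y)"
proof -
  have "cinner (c *\<^sub>C x) y = cinner x (cnj c *\<^sub>C y)"
    by (metis cinner_commute cinner_scaleC_left complex_cnj_cnj complex_cnj_mult)
  then show ?thesis
    by (simp flip: Re_cinner)
qed

text \<open>The representing vector minimises \<open>J x = inner x x - 2 * f x\<close>: by the parallelogram identity
  a minimising sequence of \<open>J\<close> is Cauchy, and at a minimum the derivative of \<open>J\<close> vanishes in
  every direction.\<close>

lemma riesz_representation:
  fixes f :: "'a::{real_inner, complete_space} \<Rightarrow> real"
  assumes "bounded_linear f"
  obtains z where "\<And>x. f x = inner x z"
proof -
  interpret f: bounded_linear f by fact
  define J where "J x = inner x x - 2 * f x" for x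
  obtain B where B: "\<And>x. norm (f x) \<le> norm x * B"
    using f.bounded by blast
  have lower: "- B\<^sup>2 \<le> J x" for x
  proof -
    have "f x \<le> norm x * B" using B [of x] by simp
    moreover have "0 \<le> (norm x - B)\<^sup>2" by simp
    ultimately show ?thesis
      unfolding J_def power2_norm_eq_inner [symmetric] by (simp add: power2_diff algebra_simps)
  qed
  define m where "m = Inf (range J)"
  have bdd: "bdd_below (range J)"
    using lower by (intro bdd_belowI) auto
  then have m: "m \<le> J x" for x
    unfolding m_def by (intro cInf_lower) auto
  have "\<exists>x. J x < m + 1 / real (Suc n)" for n
  proof -
    have "Inf (range J) < m + 1 / real (Suc n)" by (simp add: m_def)
    then show ?thesis
      using cInf_lessD [of "range J"] by auto
  qed
  then obtain x where x: "\<And>n. J (x n) < m + 1 / real (Suc n)"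
    by metis
  have mid: "(norm (u - v))\<^sup>2 \<le> 2 * (J u + J v - 2 * m)" for u v
  proof -
    have "(norm (u - v))\<^sup>2 = 2 * (J u + J v - 2 * J ((1/2) *\<^sub>R (u + v)))"
      unfolding J_def power2_norm_eq_inner
      by (simp add: f.add f.scaleR inner_add inner_diff inner_commute algebra_simps)
    then show ?thesis
      using m [of "(1/2) *\<^sub>R (u + v)"] by simp
  qed
  have "Cauchy x"
  proof (rule metric_CauchyI)
    fix e :: real assume "0 < e"
    then obtain N where N: "1 / real (Suc N) < e\<^sup>2 / 4"
      using nat_approx_posE [of "e\<^sup>2 / 4"] by auto
    have "dist (x i) (x j) < e" if "N \<le> i" "N \<le> j" for i j
    proof -
      have "J (x k) < m + e\<^sup>2 / 4" if "N \<le> k" for k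
      proof -
        have "1 / real (Suc k) \<le> 1 / real (Suc N)"
          using that by (simp add: frac_le)
        with N x [of k] show ?thesis by linarith
      qed
      from this [of i] this [of j] that mid [of "x i" "x j"]
      have "(norm (x i - x j))\<^sup>2 < e\<^sup>2" by auto
      then show ?thesis
        using \<open>0 < e\<close> by (simp add: dist_norm power_less_imp_less_base)
    qed
    then show "\<exists>M. \<forall>i\<ge>M. \<forall>j\<ge>M. dist (x i) (x j) < e" by blast
  qed
  then obtain z where z: "x \<longlonglongrightarrow> z"
    using Cauchy_convergent convergent_def by blast
  have "(\<lambda>n. J (x n)) \<longlonglongrightarrow> J z"
    unfolding J_def by (intro tendsto_intros f.tendsto z)
  moreover have "(\<lambda>n. m + 1 / real (Suc n)) \<longlonglongrightarrow> m + 0"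
    by (intro tendsto_add tendsto_const LIMSEQ_Suc [OF lim_1_over_n])
  ultimately have Jz: "J z \<le> m"
    using x by (intro LIMSEQ_le) (auto intro: less_imp_le)
  have "f h = inner h z" for h
  proof -
    let ?c = "inner h z - f h"
    \<comment> \<open>Up to the summand \<open>1\<close>, which keeps the denominator positive, the minimiser of the quadratic
      polynomial in \<open>t\<close> below.\<close>
    define t where "t = - ?c / (1 + inner h h)"
    have "J (z + t *\<^sub>R h) = J z + t\<^sup>2 * inner h h + 2 * t * ?c"
      unfolding J_def
      by (simp add: f.add f.scaleR inner_add inner_commute power2_eq_square algebra_simps)
    then have 1: "0 \<le> t\<^sup>2 * inner h h + 2 * t * ?c"
      using m [of "z + t *\<^sub>R h"] Jz by simp
    have 2: "0 < 1 + inner h h"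
      by (simp add: add_pos_nonneg)
    then have "t * (1 + inner h h) = - ?c"
      by (simp add: t_def)
    then have "?c = - t * (1 + inner h h)" by simp
    with 1 have "0 \<le> - (t\<^sup>2 * (2 + inner h h))"
      by (simp add: power2_eq_square algebra_simps)
    moreover have "0 < 2 + inner h h" using 2 by simp
    ultimately have "t = 0"
      by (smt (verit) mult_pos_pos zero_less_power2)
    then show ?thesis
      using \<open>?c = _\<close> by simp
  qed
  then show thesis by (rule that)
qed

text \<open>Weak limits of contractions first arise as bilinear forms; this turns such a form back
  into a contraction.\<close>

lemma bounded_form_imp_operator:
  fixes b :: "'a::{real_inner, complete_space} \<Rightarrow> 'a \<Rightarrow> real"
  assumes "bounded_bilinear b" and bound: "\<And>x y. \<bar>b x y\<bar> \<le> norm x * norm y"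
  obtains A :: "'a \<Rightarrow>\<^sub>L 'a" where "norm A \<le> 1" "\<And>x y. inner (A x) y = b x y"
proof -
  interpret b: bounded_bilinear b by fact
  have "\<exists>z. \<forall>y. b x y = inner y z" for x
    using riesz_representation [OF b.bounded_linear_right [of x]] by blast
  then obtain a where a: "\<And>x y. inner y (a x) = b x y"
    by metis
  have norm_a: "norm (a x) \<le> norm x" for x
  proof -
    have "norm (a x) * norm (a x) \<le> norm x * norm (a x)"
      using bound [of x "a x"] a [of "a x" x] by (simp add: dot_square_norm power2_eq_square)
    then show ?thesis
      by (cases "a x = 0") auto
  qed
  have "bounded_linear a"
  proof (rule bounded_linear_intro)
    show "a (x + y) = a x + a y" for x y
      by (rule vector_eq_ldot [THEN iffD1]) (simp add: a inner_add_right b.add_left)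
    show "a (r *\<^sub>R x) = r *\<^sub>R a x" for r x
      by (rule vector_eq_ldot [THEN iffD1]) (simp add: a b.scaleR_left)
    show "norm (a x) \<le> norm x * 1" for x
      using norm_a by simp
  qed
  then have A: "blinfun_apply (Blinfun a) = a"
    by (rule bounded_linear_Blinfun_apply)
  show thesis
  proof (rule that [of "Blinfun a"])
    show "norm (Blinfun a) \<le> 1"
      by (rule norm_blinfun_bound) (simp_all add: A norm_a)
    show "inner (Blinfun a x) y = b x y" for x y
      by (simp add: A a inner_commute [of "a x"])
  qed
qed

lemma adjoint_exists:
  fixes A :: "'a::{real_inner, complete_space} \<Rightarrow>\<^sub>L 'a"
  obtains B where "\<And>x y. inner (A x) y = inner x (B y)"
proof -
  have "bounded_linear (\<lambda>x. inner (A x) y)" for y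
    by (intro bounded_linear_intros)
  then have "\<exists>z. \<forall>x. inner (A x) y = inner x z" for y
    using riesz_representation by metis
  then show thesis using that by metis
qed

text \<open>The norm is a limit of maxima of finitely many weakly continuous functionals. This is what
  makes it a function of Baire class one for the weak topology, although it is in general
  not weakly continuous. The nonzero vectors among the \<open>sgn (d k)\<close> are dense in the unit sphere.\<close>

lemma norm_eq_limit_Max_inner:
  fixes d :: "nat \<Rightarrow> 'a::real_inner"
  assumes dense: "\<And>x e. 0 < e \<Longrightarrow> \<exists>n. norm (x - d n) < e"
  shows "(\<lambda>n. MAX k\<in>{..n}. \<bar>inner x (sgn (d k))\<bar>) \<longlonglongrightarrow> norm x"
proof (rule LIMSEQ_I)
  fix e :: real assume "0 < e"
  have le: "\<bar>inner x (sgn (d k))\<bar> \<le> norm x" for k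
    using Cauchy_Schwarz_ineq2 [of x "sgn (d k)"]
    by (auto simp: norm_sgn split: if_splits)
  obtain k where k: "norm (x - d k) < e / 2"
    using dense [of "e / 2" x] \<open>0 < e\<close> by auto
  have "inner (d k) (sgn (d k)) = norm (d k)"
    by (cases "d k = 0") (simp_all add: sgn_div_norm dot_square_norm power2_eq_square)
  moreover have "\<bar>inner (x - d k) (sgn (d k))\<bar> \<le> norm (x - d k)"
    using Cauchy_Schwarz_ineq2 [of "x - d k" "sgn (d k)"]
    by (auto simp: norm_sgn split: if_splits)
  moreover have "norm x \<le> norm (d k) + norm (x - d k)"
    by (metis add.commute norm_triangle_sub)
  ultimately have ge: "norm x - e < \<bar>inner x (sgn (d k))\<bar>"
    using k by (simp add: inner_diff_left)
  have "norm ((MAX k\<in>{..n}. \<bar>inner x (sgn (d k))\<bar>) - norm x) < e" if "k \<le> n" for n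
  proof -
    have "(MAX k\<in>{..n}. \<bar>inner x (sgn (d k))\<bar>) \<le> norm x"
      using le by simp
    moreover have "\<bar>inner x (sgn (d k))\<bar> \<le> (MAX k\<in>{..n}. \<bar>inner x (sgn (d k))\<bar>)"
      using that by (intro Max_ge) auto
    ultimately show ?thesis using ge \<open>0 < e\<close> by simp
  qed
  then show "\<exists>N. \<forall>n\<ge>N. norm ((MAX k\<in>{..n}. \<bar>inner x (sgn (d k))\<bar>) - norm x) < e"
    by blast
qed

section \<open>Facts of general topology\<close>

lemma continuous_map_Max:
  fixes f :: "'i \<Rightarrow> 'a \<Rightarrow> real"
  assumes "finite I" "I \<noteq> {}" "\<And>i. i \<in> I \<Longrightarrow> continuous_map X euclideanreal (f i)"
  shows "continuous_map X euclideanreal (\<lambda>x. MAX i\<in>I. f i x)"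
  using assms
proof (induction rule: finite_ne_induct)
  case (insert i I)
  then show ?case
    by (simp add: continuous_map_real_max)
qed simp

text \<open>The limit \<open>g x\<close> is zero exactly when \<open>h n x\<close> comes arbitrarily close to \<open>0\<close> for arbitrarily
  large \<open>n\<close>, because the sequence is known to converge; the latter condition is a countable
  intersection of open ones.\<close>

lemma gdelta_in_zeros_of_pointwise_limit:
  fixes h :: "nat \<Rightarrow> 'a \<Rightarrow> real"
  assumes cont: "\<And>n. continuous_map X euclideanreal (h n)"
    and lim: "\<And>x. x \<in> topspace X \<Longrightarrow> (\<lambda>n. h n x) \<longlonglongrightarrow> g x"
  shows "gdelta_in X {x \<in> topspace X. g x = 0}"
proof -
  define U where "U = (\<lambda>(k, N). {x \<in> topspace X. \<exists>n\<ge>N. \<bar>h n x\<bar> < 1 / real (Suc k)})"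
  have "openin X (U p)" for p
  proof -
    obtain k N where p: "p = (k, N)" by fastforce
    have "U p = (\<Union>n\<in>{N..}. {x \<in> topspace X. h n x \<in> {- (1 / real (Suc k))<..<1 / real (Suc k)}})"
      by (auto simp: U_def p abs_less_iff)
    moreover have "openin X {x \<in> topspace X. h n x \<in> {- (1 / real (Suc k))<..<1 / real (Suc k)}}" for n
      using cont by (rule openin_continuous_map_preimage) simp
    ultimately show ?thesis by auto
  qed
  then have "gdelta_in X (\<Inter>(range U))"
    by (intro gdelta_in_Inter) (auto intro: open_imp_gdelta_in)
  moreover have "\<Inter>(range U) = {x \<in> topspace X. g x = 0}"
  proof (intro equalityI subsetI)
    fix x assume x: "x \<in> \<Inter>(range U)"
    then have X: "x \<in> topspace X" by (auto simp: U_def)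
    have "g x = 0"
    proof (rule ccontr)
      assume "g x \<noteq> 0"
      then obtain k where k: "1 / real (Suc k) < \<bar>g x\<bar> / 2"
        using nat_approx_posE [of "\<bar>g x\<bar> / 2"] by auto
      obtain N where N: "\<And>n. n \<ge> N \<Longrightarrow> \<bar>h n x - g x\<bar> < \<bar>g x\<bar> / 2"
        using LIMSEQ_D [OF lim [OF X], of "\<bar>g x\<bar> / 2"] \<open>g x \<noteq> 0\<close> by auto
      have "x \<in> U (k, N)" using x by auto
      then obtain n where "n \<ge> N" "\<bar>h n x\<bar> < 1 / real (Suc k)"
        by (auto simp: U_def)
      with N [of n] k show False by linarith
    qed
    with X show "x \<in> {x \<in> topspace X. g x = 0}" by simp
  next
    fix x assume x: "x \<in> {x \<in> topspace X. g x = 0}"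
    have "x \<in> U (k, N)" for k N
    proof -
      obtain N' where "\<And>n. n \<ge> N' \<Longrightarrow> \<bar>h n x\<bar> < 1 / real (Suc k)"
        using LIMSEQ_D [OF lim [of x], of "1 / real (Suc k)"] x by auto
      then show ?thesis
        using x by (auto simp: U_def intro: exI [of _ "max N N'"])
    qed
    then show "x \<in> \<Inter>(range U)" by auto
  qed
  ultimately show ?thesis by simp
qed

lemma separable_metrizable_imp_second_countable:
  assumes "metrizable_space X" "separable_space X"
  shows "second_countable X"
proof -
  obtain M d where "Metric_space M d" and X: "X = Metric_space.mtopology M d"
    using assms(1) metrizable_space_def by blast
  then interpret Metric_space M d by blast
  obtain C where C: "countable C" "C \<subseteq> M" "mtopology closure_of C = M"
    using assms(2) by (auto simp: separable_space_def X)
  define \<B> where "\<B> = (\<lambda>(c, n). mball c (1 / real (Suc n))) ` (C \<times> UNIV)"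
  have "\<exists>V\<in>\<B>. x \<in> V \<and> V \<subseteq> U" if U: "openin mtopology U" "x \<in> U" for U x
  proof -
    obtain r where r: "0 < r" "mball x r \<subseteq> U" and "x \<in> M"
      using U openin_mtopology by (metis in_mono)
    obtain n where n: "1 / real (Suc n) < r / 2"
      using nat_approx_posE [of "r / 2"] r by auto
    have "x \<in> mtopology closure_of C" using C \<open>x \<in> M\<close> by simp
    moreover have "0 < 1 / real (Suc n)" by simp
    ultimately obtain c where c: "c \<in> C" "c \<in> mball x (1 / real (Suc n))"
      unfolding metric_closure_of by blast
    have "mball c (1 / real (Suc n)) \<subseteq> mball x r"
    proof
      fix y assume y: "y \<in> mball c (1 / real (Suc n))"
      have "d x y \<le> d x c + d c y"
        using y c \<open>x \<in> M\<close> by (intro triangle) auto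
      then show "y \<in> mball x r"
        using y c n by simp
    qed
    moreover have "x \<in> mball c (1 / real (Suc n))"
      using c by (simp add: commute)
    ultimately show ?thesis
      using c(1) r(2) unfolding \<B>_def by blast
  qed
  moreover have "countable \<B>"
    using C(1) by (simp add: \<B>_def)
  moreover have "\<forall>V\<in>\<B>. openin mtopology V"
    by (auto simp: \<B>_def)
  ultimately show ?thesis
    unfolding second_countable_def X by blast
qed

lemma polish_imp_second_countable: "polish_topology X \<Longrightarrow> second_countable X"
  unfolding polish_topology_def
  by (simp add: completely_metrizable_imp_metrizable_space separable_metrizable_imp_second_countable)

text \<open>A countable exhaustion of the space in functional form: every compact set is covered by
  finitely many of the open sets \<open>{x. 1/2 < \<phi> n x}\<close>, so uniform convergence on compact sets is
  uniform convergence on the whole space after multiplication with each \<open>\<phi> n\<close>. The functions come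
  from complete regularity, and countably many suffice by the Lindelof property.\<close>

lemma bump_functions:
  assumes lc: "locally_compact_space (euclidean :: 'm::topological_space topology)"
    and pol: "polish_topology (euclidean :: 'm::topological_space topology)"
  obtains \<phi> :: "nat \<Rightarrow> 'm::topological_space \<Rightarrow> real" and K :: "nat \<Rightarrow> 'm set"
  where "\<And>n. continuous_on UNIV (\<phi> n)" "\<And>n x. \<bar>\<phi> n x\<bar> \<le> 1"
    "\<And>n. compact (K n)" "\<And>n x. x \<notin> K n \<Longrightarrow> \<phi> n x = 0" "\<And>x. \<exists>n. 1/2 < \<phi> n x"
proof -
  define good :: "('m \<Rightarrow> real) \<Rightarrow> bool" where
    "good f \<longleftrightarrow> continuous_on UNIV f \<and> (\<forall>x. \<bar>f x\<bar> \<le> 1) \<and> (\<exists>K. compact K \<and> (\<forall>x. x \<notin> K \<longrightarrow> f x = 0))"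
    for f
  define \<U> where "\<U> = {{x. 1/2 < f x} | f. good f}"
  have creg: "completely_regular_space (euclidean :: 'm topology)"
    using pol unfolding polish_topology_def
    by (simp add: completely_metrizable_imp_metrizable_space metrizable_imp_completely_regular_space)
  have ex: "\<exists>f. good f \<and> f x = 1" for x
  proof -
    obtain U K where UK: "open U" "compact K" "x \<in> U" "U \<subseteq> K"
      using lc unfolding locally_compact_space_def by (simp add: compactin_euclidean_iff) metis
    then obtain f where f: "continuous_map (euclidean :: 'm topology) (top_of_set {0..1}) f"
      "f x = (0::real)" "f ` (- U) \<subseteq> {1}"
      using creg unfolding completely_regular_space_def
      by (metis ComplD Compl_eq_Diff_UNIV DiffI UNIV_I closed_Compl closed_closedin topspace_euclidean)
    have cont: "continuous_on UNIV f" and range: "0 \<le> f y" "f y \<le> 1" for y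
      using f(1) by (auto simp: continuous_map_in_subtopology Pi_iff image_subset_iff)
    have "good (\<lambda>y. 1 - f y)"
      unfolding good_def
    proof (intro conjI exI [of _ K])
      show "continuous_on UNIV (\<lambda>y. 1 - f y)"
        by (intro continuous_intros cont)
      show "\<forall>y. \<bar>1 - f y\<bar> \<le> 1"
        using range by (auto simp: abs_le_iff add_increasing2)
      show "\<forall>y. y \<notin> K \<longrightarrow> 1 - f y = 0"
        using f(3) UK(4) by auto
    qed (fact UK(2))
    then show ?thesis using f(2) by (intro exI [of _ "\<lambda>y. 1 - f y"]) simp
  qed
  have "Lindelof_space (euclidean :: 'm topology)"
    using pol by (intro second_countable_imp_Lindelof_space polish_imp_second_countable)
  moreover have "open U" if "U \<in> \<U>" for U
    using that by (auto simp: \<U>_def good_def intro!: open_Collect_less continuous_intros)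
  moreover have "x \<in> \<Union>\<U>" for x
  proof -
    obtain f where "good f" "f x = 1" using ex by blast
    then show ?thesis by (auto simp: \<U>_def intro!: exI [of _ "{x. 1/2 < f x}"])
  qed
  ultimately obtain \<V> where \<V>: "countable \<V>" "\<V> \<subseteq> \<U>" "\<Union>\<V> = UNIV"
    unfolding Lindelof_space_def by (metis UNIV_eq_I open_openin topspace_euclidean)
  then have "\<V> \<noteq> {}" by auto
  have "from_nat_into \<V> n \<in> \<U>" for n
    using \<V>(2) from_nat_into [OF \<open>\<V> \<noteq> {}\<close>] by blast
  then have "\<forall>n. \<exists>f. good f \<and> from_nat_into \<V> n = {x. 1/2 < f x}"
    unfolding \<U>_def by blast
  then obtain \<phi> where \<phi>: "\<And>n. good (\<phi> n)" "\<And>n. from_nat_into \<V> n = {x. 1/2 < \<phi> n x}"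
    by metis
  then obtain K where "\<And>n. compact (K n)" "\<And>n x. x \<notin> K n \<Longrightarrow> \<phi> n x = 0"
    unfolding good_def by metis
  moreover have "\<exists>n. 1/2 < \<phi> n x" for x
  proof -
    obtain V where "V \<in> \<V>" "x \<in> V" using \<V>(3) UNIV_I UnionE by metis
    with \<V>(1) \<phi>(2) show ?thesis
      by (metis from_nat_into_to_nat_on mem_Collect_eq)
  qed
  ultimately show thesis
    using that [of \<phi> K] \<phi>(1) unfolding good_def by blast
qed

text \<open>Up to a small error, a function \<open>g\<close> is determined on \<open>K\<close> by a finite set of pairs of a basic
  open set and a rational number to which \<open>g\<close> is close on that set. There are only countably many
  such finite sets, and one function chosen for each of them gives \<open>Q\<close>.\<close>

lemma separable_bcontfun_supported_on_compact:
  assumes sc: "second_countable (euclidean :: 'm::topological_space topology)" and K: "compact K"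
  obtains Q :: "('m::topological_space \<Rightarrow>\<^sub>C real) set" where "countable Q"
    "\<And>g e. (\<And>x. x \<notin> K \<Longrightarrow> apply_bcontfun g x = 0) \<Longrightarrow> 0 < e \<Longrightarrow> \<exists>q\<in>Q. dist g q < e"
proof -
  obtain \<B> :: "'m set set" where "countable \<B>" "\<forall>B\<in>\<B>. openin euclidean B"
    "\<forall>U x. openin euclidean U \<and> x \<in> U \<longrightarrow> (\<exists>B\<in>\<B>. x \<in> B \<and> B \<subseteq> U)"
    using sc unfolding second_countable_def by (elim exE conjE)
  then have \<B>: "countable \<B>" "\<And>B. B \<in> \<B> \<Longrightarrow> open B"
    "\<And>U x. open U \<Longrightarrow> x \<in> U \<Longrightarrow> \<exists>B\<in>\<B>. x \<in> B \<and> B \<subseteq> U"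
    unfolding open_openin [symmetric] by blast+
  define fits :: "real \<Rightarrow> ('m set \<times> real) set \<Rightarrow> ('m \<Rightarrow>\<^sub>C real) \<Rightarrow> bool" where
    "fits e L g \<longleftrightarrow> (\<forall>x. x \<notin> K \<longrightarrow> g x = 0) \<and> (\<forall>(B, q)\<in>L. \<forall>x\<in>B. \<bar>g x - q\<bar> < e)" for e L g
  define \<L> where "\<L> = {L. L \<subseteq> \<B> \<times> (\<rat> :: real set) \<and> finite L}"
  define Q where "Q = (\<lambda>(n, L). SOME g. fits (1 / real (Suc n)) L g) ` (UNIV \<times> \<L>)"
  show thesis
  proof
    have "countable \<L>"
      unfolding \<L>_def conj_commute [of "_ \<subseteq> _"]
      by (intro countable_Collect_finite_subset countable_SIGMA \<B>(1) countable_rat)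
    then show "countable Q"
      by (simp add: Q_def)
  next
    fix g :: "'m \<Rightarrow>\<^sub>C real" and e :: real
    assume g: "\<And>x. x \<notin> K \<Longrightarrow> g x = 0" and "0 < e"
    then obtain n where n: "1 / real (Suc n) < e / 3"
      using nat_approx_posE [of "e / 3"] by auto
    let ?\<delta> = "1 / real (Suc n)"
    define C where "C = {(B, q). B \<in> \<B> \<and> q \<in> \<rat> \<and> (\<forall>x\<in>B. \<bar>g x - q\<bar> < ?\<delta>)}"
    have "K \<subseteq> (\<Union>p\<in>C. fst p)"
    proof
      fix x
      obtain q where q: "q \<in> \<rat>" "g x < q" "q < g x + ?\<delta>"
        using Rats_dense_in_real [of "g x" "g x + ?\<delta>"] by auto
      have "open {y. \<bar>g y - q\<bar> < ?\<delta>}"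
        by (intro open_Collect_less continuous_intros continuous_on_apply_bcontfun)
      moreover have "x \<in> {y. \<bar>g y - q\<bar> < ?\<delta>}"
        using q by auto
      ultimately obtain B where "B \<in> \<B>" "x \<in> B" "B \<subseteq> {y. \<bar>g y - q\<bar> < ?\<delta>}"
        using \<B>(3) by blast
      with q have "(B, q) \<in> C" by (auto simp: C_def)
      with \<open>x \<in> B\<close> show "x \<in> (\<Union>p\<in>C. fst p)" by force
    qed
    moreover have "open (fst p)" if "p \<in> C" for p
      using that \<B>(2) by (auto simp: C_def)
    ultimately obtain L where L: "L \<subseteq> C" "finite L" "K \<subseteq> (\<Union>p\<in>L. fst p)"
      using compactE_image [OF K, of C fst] by metis
    define h where "h = (SOME g. fits ?\<delta> L g)"
    have fg: "fits ?\<delta> L g"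
      using g L(1) by (auto simp: fits_def C_def)
    then have fh: "fits ?\<delta> L h"
      unfolding h_def by (rule someI)
    have "dist (g x) (h x) \<le> 2 * ?\<delta>" for x
    proof (cases "x \<in> K")
      case True
      then obtain p where p: "p \<in> L" "x \<in> fst p" using L(3) by blast
      have "\<bar>g x - snd p\<bar> < ?\<delta>" "\<bar>h x - snd p\<bar> < ?\<delta>"
        using fg fh p unfolding fits_def by (auto simp: case_prod_unfold)
      then show ?thesis unfolding dist_real_def by linarith
    next
      case False
      with fg fh have "g x = 0" "h x = 0" by (auto simp: fits_def)
      then show ?thesis by simp
    qed
    then have "dist g h \<le> 2 * ?\<delta>" by (rule dist_bound)
    then have "dist g h < e" using n \<open>0 < e\<close> by linarith
    moreover have "h \<in> Q"
      unfolding Q_def h_def using L(1,2) by (auto simp: \<L>_def C_def intro!: image_eqI [of _ _ "(n, L)"])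
    ultimately show "\<exists>q\<in>Q. dist g q < e" by blast
  qed
qed

text \<open>The sup metric is complete over an arbitrary topological domain, since uniform limits of
  continuous functions are continuous. The monoid enters with its topology alone, without a
  chosen metric.\<close>

instance bcontfun :: (topological_space, complete_space) complete_space
proof
  fix f :: "nat \<Rightarrow> 'a \<Rightarrow>\<^sub>C 'b"
  assume f: "Cauchy f"
  have "uniformly_Cauchy_on UNIV (\<lambda>n. apply_bcontfun (f n))"
  proof (rule uniformly_Cauchy_onI)
    fix e :: real assume "0 < e"
    then obtain M where M: "\<forall>m\<ge>M. \<forall>n\<ge>M. dist (f m) (f n) < e"
      using metric_CauchyD [OF f] by blast
    then have "\<forall>x\<in>UNIV. \<forall>m\<ge>M. \<forall>n\<ge>M. dist (f m x) (f n x) < e"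
      by (intro ballI allI impI dist_fun_lt_imp_dist_val_lt) simp
    then show "\<exists>M. \<forall>x\<in>UNIV. \<forall>m\<ge>M. \<forall>n\<ge>M. dist (f m x) (f n x) < e" ..
  qed
  then obtain g where "uniform_limit UNIV (\<lambda>n. apply_bcontfun (f n)) g sequentially"
    using Cauchy_uniformly_convergent unfolding uniformly_convergent_on_def by blast
  then obtain l where "f \<longlonglongrightarrow> l"
    by (rule uniform_limit_bcontfunE) simp
  then show "convergent f"
    by (rule convergentI)
qed

lemma tendsto_fun_iff:
  fixes f :: "'a \<Rightarrow> 'i \<Rightarrow> 'b::topological_space"
  shows "(f \<longlongrightarrow> l) F \<longleftrightarrow> (\<forall>i. ((\<lambda>a. f a i) \<longlongrightarrow> l i) F)"
proof -
  have "(f \<longlongrightarrow> l) F \<longleftrightarrow> limitin (product_topology (\<lambda>i. euclidean) UNIV) f l F"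
    by (simp add: euclidean_product_topology)
  then show ?thesis
    by (simp add: limitin_componentwise)
qed

text \<open>The approximating sets \<open>Q i\<close> are allowed to lie outside \<open>A\<close>: being a subset of a separable
  metrizable space, \<open>A\<close> is still second countable.\<close>

lemma second_countable_product_subset:
  fixes A :: "('i::countable \<Rightarrow> 'b::metric_space) set"
  assumes Q: "\<And>i. countable (Q i)"
    and dense: "\<And>z i e. z \<in> A \<Longrightarrow> 0 < e \<Longrightarrow> \<exists>q\<in>Q i. dist (z i) q < e"
  shows "second_countable (top_of_set A)"
proof -
  define I where "I N = {i :: 'i. to_nat i < N}" for N :: nat
  have finI: "finite (I N)" for N
  proof -
    have "I N = to_nat -` {..<N}" by (auto simp: I_def)
    then show ?thesis by (simp add: finite_vimageI)
  qed
  \<comment> \<open>Members of \<open>PiE (I N) Q\<close> have the arbitrary value \<open>undefined\<close> outside \<open>I N\<close>. This does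
    not disturb coordinatewise convergence, since every index lies in almost all of the \<open>I N\<close>.\<close>
  define D where "D = (\<Union>N. PiE (I N) Q)"
  have "countable D"
    unfolding D_def using finI Q by (intro countable_UN countable_PiE) auto
  have "A \<subseteq> closure D"
  proof
    fix z assume z: "z \<in> A"
    have "\<exists>x\<in>PiE (I N) Q. \<forall>i\<in>I N. dist (z i) (x i) < 1 / real (Suc N)" for N
    proof -
      have "\<forall>i. \<exists>q\<in>Q i. dist (z i) q < 1 / real (Suc N)"
        using dense [OF z] by simp
      then obtain q where "\<And>i. q i \<in> Q i" "\<And>i. dist (z i) (q i) < 1 / real (Suc N)"
        by metis
      then show ?thesis
        by (intro bexI [of _ "restrict q (I N)"]) auto
    qed
    then obtain x where x: "\<And>N. x N \<in> PiE (I N) Q"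
      and near: "\<And>N i. i \<in> I N \<Longrightarrow> dist (z i) (x N i) < 1 / real (Suc N)"
      by metis
    have "(\<lambda>N. x N i) \<longlonglongrightarrow> z i" for i
    proof (rule metric_LIMSEQ_I)
      fix e :: real assume "0 < e"
      then obtain M where M: "1 / real (Suc M) < e"
        by (rule nat_approx_posE)
      have "dist (x N i) (z i) < e" if "N \<ge> max M (Suc (to_nat i))" for N
      proof -
        have "1 / real (Suc N) \<le> 1 / real (Suc M)"
          using that by (simp add: frac_le)
        moreover have "dist (x N i) (z i) < 1 / real (Suc N)"
          using near [of i N] that by (simp add: I_def dist_commute)
        ultimately show ?thesis using M by linarith
      qed
      then show "\<exists>no. \<forall>N\<ge>no. dist (x N i) (z i) < e" by blast
    qed
    then have "x \<longlonglongrightarrow> z"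
      by (simp add: tendsto_fun_iff)
    moreover have "x N \<in> D" for N using x by (auto simp: D_def)
    ultimately show "z \<in> closure D"
      unfolding closure_sequential by blast
  qed
  have "separable_space (top_of_set (closure D))"
    unfolding separable_space_def
    using \<open>countable D\<close> closure_subset [of D]
    by (intro exI [of _ D]) (auto simp: closure_of_subtopology Int_absorb1)
  then have "second_countable (top_of_set (closure D))"
    by (intro separable_metrizable_imp_second_countable metrizable_space_subtopology metrizable_space_euclidean)
  then have "second_countable (subtopology (top_of_set (closure D)) A)"
    by (rule second_countable_subtopology)
  then show ?thesis
    using \<open>A \<subseteq> closure D\<close> by (simp add: subtopology_subtopology Int_absorb1)
qed

section \<open>Weakly continuous maps into the contractions\<close>

lemma continuous_map_weak_operator_topology_iff_inner:
  fixes f :: "'a \<Rightarrow> 'h::complex_hilbert \<Rightarrow>\<^sub>L 'h"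
  shows "continuous_map X weak_operator_topology f \<longleftrightarrow>
    (\<forall>x y. continuous_map X euclideanreal (\<lambda>t. inner (f t x) y))"
proof
  assume "continuous_map X weak_operator_topology f"
  then have "continuous_map X euclidean (\<lambda>t. cinner (f t x) y)" for x y
    by (simp add: continuous_map_weak_operator_topology_iff)
  then have "continuous_map X euclideanreal (Re \<circ> (\<lambda>t. cinner (f t x) y))" for x y
    by (rule continuous_map_compose) (simp add: continuous_on_Re)
  then show "\<forall>x y. continuous_map X euclideanreal (\<lambda>t. inner (f t x) y)"
    by (simp add: o_def Re_cinner)
next
  assume *: "\<forall>x y. continuous_map X euclideanreal (\<lambda>t. inner (f t x) y)"
  show "continuous_map X weak_operator_topology f"
    unfolding continuous_map_weak_operator_topology_iff
  proof (intro allI)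
    show "continuous_map X euclidean (\<lambda>t. cinner (f t x) y)" for x y
      using * unfolding cinner_eq_Complex_inner continuous_map_atin
      by (auto intro!: tendsto_Complex)
  qed
qed

lemma cmod_cinner_le: "cmod (cinner x y) \<le> \<bar>inner x y\<bar> + \<bar>inner x (\<i> *\<^sub>C y)\<bar>"
  unfolding cinner_eq_Complex_inner using cmod_le [of "Complex _ _"] by simp

lemma abs_inner_le_cmod_cinner: "\<bar>inner x y\<bar> \<le> cmod (cinner x y)"
  by (metis Re_cinner abs_Re_le_cmod)

lemma weak_sup_distD:
  assumes "weak_sup_dist K x y S T < ennreal e" "t \<in> K"
  shows "\<bar>inner (S t x) y - inner (T t x) y\<bar> < e"
proof -
  have "ennreal (cmod (cinner ((S t - T t) x) y)) \<le> weak_sup_dist K x y S T"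
    unfolding weak_sup_dist_def using assms(2) by (rule SUP_upper)
  also note assms(1)
  finally have "cmod (cinner ((S t - T t) x) y) < e"
    by (simp add: ennreal_less_iff)
  with abs_inner_le_cmod_cinner [of "(S t - T t) x" y] show ?thesis
    by (simp add: blinfun.diff_left inner_diff_left)
qed

lemma limitin_k_WOT_real:
  fixes f :: "'i \<Rightarrow> 'm::topological_space \<Rightarrow> 'h::complex_hilbert \<Rightarrow>\<^sub>L 'h"
    and T :: "'m \<Rightarrow> 'h \<Rightarrow>\<^sub>L 'h"
  assumes "\<And>K x y e. compact K \<Longrightarrow> 0 < e \<Longrightarrow> \<forall>\<^sub>F a in F. \<forall>t\<in>K. \<bar>inner (f a t x - T t x) y\<bar> < e"
  shows "limitin k_WOT f T F"
  unfolding limitin_k_WOT_iff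
proof (intro allI impI)
  fix K :: "'m set" and x y :: 'h
  assume K: "compact K"
  show "((\<lambda>a. weak_sup_dist K x y (f a) T) \<longlongrightarrow> 0) F"
    unfolding order_tendsto_iff
  proof (intro conjI allI impI)
    fix c :: ennreal assume "0 < c"
    then obtain r where r: "0 < r" "r < c" using dense by blast
    then obtain e where e: "r = ennreal e" "0 \<le> e"
      by (cases r) auto
    with r have "0 < e" by simp
    have "\<forall>\<^sub>F a in F. \<forall>t\<in>K. \<bar>inner (f a t x - T t x) y\<bar> < e / 2"
      "\<forall>\<^sub>F a in F. \<forall>t\<in>K. \<bar>inner (f a t x - T t x) (\<i> *\<^sub>C y)\<bar> < e / 2"
      using assms [OF K, of "e / 2"] \<open>0 < e\<close> by (simp_all only: half_gt_zero)
    then show "\<forall>\<^sub>F a in F. weak_sup_dist K x y (f a) T < c"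
    proof eventually_elim
      case (elim a)
      have "weak_sup_dist K x y (f a) T \<le> ennreal e"
        unfolding weak_sup_dist_def
      proof (rule SUP_least)
        fix t assume "t \<in> K"
        with elim have "\<bar>inner (f a t x - T t x) y\<bar> < e / 2"
          "\<bar>inner (f a t x - T t x) (\<i> *\<^sub>C y)\<bar> < e / 2" by auto
        then have "cmod (cinner (f a t x - T t x) y) \<le> e"
          using cmod_cinner_le [of "f a t x - T t x" y] by linarith
        then show "ennreal (cmod (cinner ((f a t - T t) x) y)) \<le> ennreal e"
          by (simp add: blinfun.diff_left ennreal_leI)
      qed
      with r e show ?case by simp
    qed
  qed auto
qed

text \<open>The ambient space in which the semigroups form a \<open>G\<^sub>\<delta>\<close> set. In contrast to the semigroup
  law, the conditions imposed here survive limits in \<^const>\<open>k_WOT\<close> when the domain is locally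
  compact.\<close>

definition weak_contraction_maps :: "('m::topological_space \<Rightarrow> 'h::complex_hilbert \<Rightarrow>\<^sub>L 'h) set"
  where "weak_contraction_maps =
    {T. range T \<subseteq> contractions \<and> continuous_map euclidean weak_operator_topology T}"

lemma weak_contraction_maps_norm: "T \<in> weak_contraction_maps \<Longrightarrow> norm (T t) \<le> 1"
  by (auto simp: weak_contraction_maps_def contractions_def)

lemma weak_contraction_maps_continuous:
  "T \<in> weak_contraction_maps \<Longrightarrow> continuous_on UNIV (\<lambda>t. inner (T t x) y)"
  by (simp add: weak_contraction_maps_def continuous_map_weak_operator_topology_iff_inner)

lemma weak_contraction_maps_scaleC:
  "T \<in> weak_contraction_maps \<Longrightarrow> T t (c *\<^sub>C x) = c *\<^sub>C T t x"
  by (auto simp: weak_contraction_maps_def contractions_def bounded_operators_def)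

lemma contraction_inner_bound:
  assumes "norm A \<le> 1" shows "\<bar>inner (blinfun_apply A x) y\<bar> \<le> norm x * norm y"
proof -
  have "norm (A x) \<le> norm A * norm x" by (rule norm_blinfun)
  also have "\<dots> \<le> norm x" using mult_right_mono [OF assms norm_ge_zero, of x] by simp
  finally have "norm (A x) * norm y \<le> norm x * norm y" by (rule mult_right_mono) simp
  with Cauchy_Schwarz_ineq2 show ?thesis by (rule order_trans)
qed

lemma continuous_map_weak_evaluation:
  fixes t :: "'m::topological_space" and W :: "('m \<Rightarrow> 'h::complex_hilbert \<Rightarrow>\<^sub>L 'h) set"
  shows "continuous_map (subtopology k_WOT W) euclideanreal (\<lambda>T :: 'm \<Rightarrow> 'h \<Rightarrow>\<^sub>L 'h. inner (T t x) y)"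
proof (rule continuous_map_from_subtopology)
  show "continuous_map k_WOT euclideanreal (\<lambda>T::'m \<Rightarrow> 'h \<Rightarrow>\<^sub>L 'h. inner (T t x) y)"
    unfolding continuous_map_atin
  proof
    fix T :: "'m \<Rightarrow> 'h \<Rightarrow>\<^sub>L 'h" assume "T \<in> topspace k_WOT"
    then have "limitin k_WOT id T (atin k_WOT T)"
      by (intro limitin_continuous_map) auto
    then have *: "((\<lambda>S. weak_sup_dist {t} x y S T) \<longlongrightarrow> 0) (atin k_WOT T)"
      by (simp add: limitin_k_WOT_iff)
    show "limitin euclideanreal (\<lambda>T :: 'm \<Rightarrow> 'h \<Rightarrow>\<^sub>L 'h. inner (T t x) y) (inner (T t x) y) (atin k_WOT T)"
      unfolding limitin_canonical_iff
    proof (rule tendstoI)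
      fix e :: real assume "0 < e"
      then have "\<forall>\<^sub>F S in atin k_WOT T. weak_sup_dist {t} x y S T < ennreal e"
        using order_tendstoD(2) [OF *] by simp
      then show "\<forall>\<^sub>F S in atin k_WOT T. dist (inner (blinfun_apply (S t) x) y) (inner (T t x) y) < e"
        by eventually_elim (simp add: dist_real_def weak_sup_distD)
    qed
  qed
qed

text \<open>On norm-bounded sets of operators, the countably many matrix entries with respect to a dense
  sequence already decide weak convergence.\<close>

locale dense_sequence =
  fixes d :: "nat \<Rightarrow> 'h::complex_hilbert"
  assumes dense: "0 < e \<Longrightarrow> \<exists>n. norm (x - d n) < e"
begin

text \<open>The bound \<open>2\<close> is the one that holds for differences of two contractions.\<close>

lemma matrix_entry_approximation:
  assumes "0 < e"
  shows "\<exists>i j. \<forall>C. norm C \<le> 2 \<longrightarrow> \<bar>inner (blinfun_apply C x) y\<bar> \<le> \<bar>inner (blinfun_apply C (d i)) (d j)\<bar> + e"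
proof -
  have small: "\<exists>n. 2 * norm (u - d n) * r \<le> e / 2" if "0 \<le> r" for u r
  proof -
    have "0 < e / (4 * (r + 1))" using assms that by simp
    then obtain n where n: "norm (u - d n) < e / (4 * (r + 1))" using dense by blast
    have "2 * norm (u - d n) * r \<le> 2 * norm (u - d n) * (r + 1)"
      by (intro mult_left_mono) auto
    also have "\<dots> \<le> e / 2"
      using n that by (simp add: pos_less_divide_eq algebra_simps)
    finally show ?thesis by blast
  qed
  obtain i where i: "2 * norm (x - d i) * norm y \<le> e / 2" using small [of "norm y"] by auto
  obtain j where j: "2 * norm (y - d j) * norm (d i) \<le> e / 2" using small [of "norm (d i)"] by auto
  show ?thesis
  proof (intro exI allI impI)
    fix C :: "'h \<Rightarrow>\<^sub>L 'h" assume C: "norm C \<le> 2"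
    have bound: "\<bar>inner (C u) v\<bar> \<le> 2 * norm u * norm v" for u v
    proof -
      have "norm (C u) \<le> norm C * norm u" by (rule norm_blinfun)
      also have "\<dots> \<le> 2 * norm u" using C by (rule mult_right_mono) simp
      finally have "norm (C u) * norm v \<le> 2 * norm u * norm v" by (rule mult_right_mono) simp
      with Cauchy_Schwarz_ineq2 show ?thesis by (rule order_trans)
    qed
    have "inner (C x) y = inner (C (x - d i)) y + inner (C (d i)) (y - d j) + inner (C (d i)) (d j)"
      by (simp add: blinfun.diff_right inner_diff)
    then show "\<bar>inner (C x) y\<bar> \<le> \<bar>inner (C (d i)) (d j)\<bar> + e"
      using bound [of "x - d i" y] bound [of "d i" "y - d j"] i j by (simp add: mult_ac)
  qed
qed

lemma blinfun_eqI_entries: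
  fixes A B :: "'h \<Rightarrow>\<^sub>L 'h"
  assumes "\<And>i j. inner (A (d i)) (d j) = inner (B (d i)) (d j)" "norm A \<le> 1" "norm B \<le> 1"
  shows "A = B"
proof (rule blinfun_eqI)
  have "norm (A - B) \<le> 2" using norm_triangle_ineq4 [of A B] assms(2,3) by linarith
  have "\<bar>inner ((A - B) x) y\<bar> \<le> 0 + e" if e: "0 < e" for x y e
  proof -
    obtain i j where "\<bar>inner ((A - B) x) y\<bar> \<le> \<bar>inner ((A - B) (d i)) (d j)\<bar> + e"
      using matrix_entry_approximation [OF e, of x y] \<open>norm (A - B) \<le> 2\<close> by blast
    then show ?thesis by (simp add: blinfun.diff_left inner_diff_left assms(1))
  qed
  then have "\<bar>inner ((A - B) x) y\<bar> \<le> 0" for x y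
    by (rule field_le_epsilon)
  then have "inner (A x) y = inner (B x) y" for x y
    by (simp add: blinfun.diff_left inner_diff_left)
  then show "A x = B x" for x
    using vector_eq_rdot [of "A x" "B x"] by blast
qed

end

section \<open>A complete model of the space of weakly continuous contraction maps\<close>

text \<open>Here \<open>\<phi>\<close> is a sequence of bump functions as in \<open>bump_functions\<close>. The encoding below records
  the matrix entries of a map, cut off by the bumps, in a countable power of a space of bounded
  continuous functions. It is a homeomorphism onto a closed set; from there completeness and
  second countability are pulled back.\<close>

locale weak_encoding = dense_sequence d for d :: "nat \<Rightarrow> 'h::complex_hilbert" +
  fixes \<phi> :: "nat \<Rightarrow> 'm::topological_space \<Rightarrow> real" and K :: "nat \<Rightarrow> 'm set"
  assumes bump_continuous: "continuous_on UNIV (\<phi> n)"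
    and bump_le_1: "\<bar>\<phi> n t\<bar> \<le> 1"
    and compact_support: "compact (K n)"
    and bump_support: "t \<notin> K n \<Longrightarrow> \<phi> n t = 0"
    and bumps_cover: "\<exists>n. 1/2 < \<phi> n t"
begin

definition encode :: "('m \<Rightarrow> 'h \<Rightarrow>\<^sub>L 'h) \<Rightarrow> nat \<times> nat \<times> nat \<Rightarrow> 'm \<Rightarrow>\<^sub>C real"
  where "encode T = (\<lambda>(n, i, j). Bcontfun (\<lambda>t. \<phi> n t * inner (T t (d i)) (d j)))"

lemma apply_encode:
  assumes "T \<in> weak_contraction_maps"
  shows "apply_bcontfun (encode T (n, i, j)) t = \<phi> n t * inner (T t (d i)) (d j)"
proof -
  have "(\<lambda>t. \<phi> n t * inner (T t (d i)) (d j)) \<in> bcontfun"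
  proof (rule bcontfun_normI)
    show "continuous_on UNIV (\<lambda>t. \<phi> n t * inner (T t (d i)) (d j))"
      by (intro continuous_on_mult bump_continuous weak_contraction_maps_continuous assms)
    fix t
    have "\<bar>\<phi> n t\<bar> * \<bar>inner (T t (d i)) (d j)\<bar> \<le> 1 * (norm (d i) * norm (d j))"
      by (intro mult_mono bump_le_1 contraction_inner_bound weak_contraction_maps_norm assms) auto
    then show "norm (\<phi> n t * inner (T t (d i)) (d j)) \<le> norm (d i) * norm (d j)"
      by (simp add: abs_mult)
  qed
  then show ?thesis
    by (simp add: encode_def Bcontfun_inverse)
qed

lemma norm_diff_le_2:
  assumes "S \<in> weak_contraction_maps" "T \<in> weak_contraction_maps"
  shows "norm (S s - T t) \<le> 2"
  using norm_triangle_ineq4 [of "S s" "T t"] weak_contraction_maps_norm [OF assms(1), of s]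
    weak_contraction_maps_norm [OF assms(2), of t] by linarith

lemma inj_on_encode: "inj_on encode weak_contraction_maps"
proof (rule inj_onI)
  fix S T assume ST: "S \<in> weak_contraction_maps" "T \<in> weak_contraction_maps" "encode S = encode T"
  have "S t = T t" for t
  proof (rule blinfun_eqI_entries)
    fix i j
    obtain n where "1/2 < \<phi> n t" using bumps_cover by blast
    moreover have "\<phi> n t * inner (S t (d i)) (d j) = \<phi> n t * inner (T t (d i)) (d j)"
      using ST by (metis apply_encode)
    ultimately show "inner (S t (d i)) (d j) = inner (T t (d i)) (d j)" by auto
  qed (auto intro: weak_contraction_maps_norm ST)
  then show "S = T" by auto
qed

lemma tendsto_encode:
  assumes lim: "limitin k_WOT f T F"
    and W: "\<forall>\<^sub>F a in F. f a \<in> weak_contraction_maps" "T \<in> weak_contraction_maps"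
  shows "((\<lambda>a. encode (f a) p) \<longlongrightarrow> encode T p) F"
proof -
  obtain n i j where p: "p = (n, i, j)" by (cases p)
  show ?thesis
  proof (rule tendstoI)
    fix e :: real assume "0 < e"
    have "((\<lambda>a. weak_sup_dist (K n) (d i) (d j) (f a) T) \<longlongrightarrow> 0) F"
      using lim compact_support by (simp add: limitin_k_WOT_iff)
    then have "\<forall>\<^sub>F a in F. weak_sup_dist (K n) (d i) (d j) (f a) T < ennreal (e / 2)"
      using \<open>0 < e\<close> by (simp add: order_tendsto_iff)
    with W(1) show "\<forall>\<^sub>F a in F. dist (encode (f a) p) (encode T p) < e"
    proof eventually_elim
      case (elim a)
      have "dist (encode (f a) p t) (encode T p t) \<le> e / 2" for t
      proof (cases "t \<in> K n")
        case True
        have "dist (encode (f a) p t) (encode T p t)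
            = \<bar>\<phi> n t\<bar> * \<bar>inner (f a t (d i)) (d j) - inner (T t (d i)) (d j)\<bar>"
          by (simp add: p apply_encode elim(1) W(2) dist_real_def abs_mult flip: right_diff_distrib)
        also have "\<dots> \<le> 1 * (e / 2)"
          using weak_sup_distD [OF elim(2) True] by (intro mult_mono bump_le_1) auto
        finally show ?thesis by simp
      next
        case False
        then show ?thesis
          using \<open>0 < e\<close> by (simp add: p apply_encode elim(1) W(2) bump_support)
      qed
      then have "dist (encode (f a) p) (encode T p) \<le> e / 2" by (rule dist_bound)
      then show ?case using \<open>0 < e\<close> by linarith
    qed
  qed
qed

text \<open>A compact set is covered by finitely many of the sets \<open>{t. 1/2 < \<phi> n t}\<close>, and on each of them
  the modulus of an entry is less than twice that of its cut-off, unless both vanish; arbitrary vectors are then reached by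
  approximating them with members of the dense sequence.\<close>

lemma limitin_of_tendsto_encode:
  assumes lim: "\<And>p. ((\<lambda>a. encode (f a) p) \<longlongrightarrow> encode T p) F"
    and W: "\<forall>\<^sub>F a in F. f a \<in> weak_contraction_maps" "T \<in> weak_contraction_maps"
  shows "limitin k_WOT f T F"
proof (rule limitin_k_WOT_real)
  fix C :: "'m set" and x y :: 'h and e :: real
  assume C: "compact C" and "0 < e"
  then have "0 < e / 2" by simp
  obtain i j where ij: "\<And>A. norm A \<le> 2 \<Longrightarrow>
      \<bar>inner (blinfun_apply A x) y\<bar> \<le> \<bar>inner (blinfun_apply A (d i)) (d j)\<bar> + e / 2"
    using matrix_entry_approximation [OF \<open>0 < e / 2\<close>, of x y] by blast
  have "open {t. 1/2 < \<phi> n t}" for n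
    by (intro open_Collect_less continuous_intros bump_continuous)
  moreover have "C \<subseteq> (\<Union>n\<in>UNIV. {t. 1/2 < \<phi> n t})"
    using bumps_cover by auto
  ultimately obtain N where "N \<subseteq> UNIV" and N: "finite N" "C \<subseteq> (\<Union>n\<in>N. {t. 1/2 < \<phi> n t})"
    by (rule compactE_image [OF C])
  have "\<forall>\<^sub>F a in F. dist (encode (f a) (n, i, j)) (encode T (n, i, j)) < e / 4" for n
    using lim \<open>0 < e\<close> by (intro tendstoD) auto
  then have "\<forall>\<^sub>F a in F. \<forall>n\<in>N. dist (encode (f a) (n, i, j)) (encode T (n, i, j)) < e / 4"
    using N(1) by (simp add: eventually_ball_finite)
  with W(1) show "\<forall>\<^sub>F a in F. \<forall>t\<in>C. \<bar>inner (f a t x - T t x) y\<bar> < e"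
  proof eventually_elim
    case (elim a)
    show ?case
    proof
      fix t assume "t \<in> C"
      then obtain n where n: "n \<in> N" "1/2 < \<phi> n t" using N(2) by auto
      let ?c = "\<bar>inner ((f a t - T t) (d i)) (d j)\<bar>"
      have "\<phi> n t * ?c = dist (encode (f a) (n, i, j) t) (encode T (n, i, j) t)"
        using n(2) by (simp add: apply_encode elim(1) W(2) dist_real_def abs_mult blinfun.diff_left
            inner_diff_left flip: right_diff_distrib)
      also have "\<dots> < e / 4"
        using elim(2) n(1) by (blast intro: dist_fun_lt_imp_dist_val_lt)
      finally have "\<phi> n t * ?c < e / 4" .
      moreover have "1/2 * ?c \<le> \<phi> n t * ?c"
        using n(2) by (intro mult_right_mono) auto
      ultimately have "?c < e / 2" by simp
      with ij [OF norm_diff_le_2 [OF elim(1) W(2)], of t t]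
      show "\<bar>inner (f a t x - T t x) y\<bar> < e"
        by (simp add: blinfun.diff_left)
    qed
  qed
qed

lemma continuous_map_encode:
  "continuous_map (subtopology k_WOT weak_contraction_maps)
    (top_of_set (encode ` weak_contraction_maps)) encode"
proof (rule continuous_map_into_subtopology)
  let ?X = "subtopology k_WOT weak_contraction_maps :: ('m \<Rightarrow> 'h \<Rightarrow>\<^sub>L 'h) topology"
  have "continuous_map ?X euclidean (\<lambda>T. encode T p)" for p
    unfolding continuous_map_atin
  proof
    fix T :: "'m \<Rightarrow> 'h \<Rightarrow>\<^sub>L 'h" assume T: "T \<in> topspace ?X"
    then have "limitin ?X (\<lambda>S. S) T (atin ?X T)"
      by (intro limitin_continuous_map) auto
    then have "((\<lambda>S. encode S p) \<longlongrightarrow> encode T p) (atin ?X T)"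
      unfolding limitin_subtopology by (intro tendsto_encode) auto
    then show "limitin euclidean (\<lambda>T. encode T p) (encode T p) (atin ?X T)"
      by simp
  qed
  then show "continuous_map ?X euclidean encode"
    unfolding continuous_map_atin limitin_canonical_iff tendsto_fun_iff by blast
qed auto

lemma homeomorphic_space_encode:
  "(subtopology k_WOT weak_contraction_maps :: ('m \<Rightarrow> 'h \<Rightarrow>\<^sub>L 'h) topology) homeomorphic_space
    top_of_set (encode ` weak_contraction_maps)"
  unfolding homeomorphic_space_def
proof (intro exI)
  let ?W = "weak_contraction_maps :: ('m \<Rightarrow> 'h \<Rightarrow>\<^sub>L 'h) set"
  let ?A = "top_of_set (encode ` ?W)"
  let ?g = "inv_into ?W encode"
  have g: "?g (encode T) = T" if "T \<in> ?W" for T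
    using inj_on_encode that by simp
  have gW: "?g z \<in> ?W" "encode (?g z) = z" if "z \<in> encode ` ?W" for z
    using that by (auto simp: inv_into_into f_inv_into_f)
  have "continuous_map ?A k_WOT ?g"
    unfolding continuous_map_atin
  proof
    fix z assume z: "z \<in> topspace ?A"
    then have "limitin ?A (\<lambda>w. w) z (atin ?A z)"
      by (intro limitin_continuous_map) auto
    then have ev: "\<forall>\<^sub>F w in atin ?A z. w \<in> encode ` ?W" and "((\<lambda>w. w) \<longlongrightarrow> z) (atin ?A z)"
      by (simp_all add: limitin_subtopology)
    then have "((\<lambda>w. w p) \<longlongrightarrow> z p) (atin ?A z)" for p
      unfolding tendsto_fun_iff by blast
    moreover have "\<forall>\<^sub>F w in atin ?A z. w p = encode (?g w) p" for p
      using ev by eventually_elim (simp add: gW)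
    ultimately have "((\<lambda>w. encode (?g w) p) \<longlongrightarrow> z p) (atin ?A z)" for p
      by (rule Lim_transform_eventually)
    moreover have "encode (?g z) = z" using z by (intro gW) simp
    ultimately have "((\<lambda>w. encode (?g w) p) \<longlongrightarrow> encode (?g z) p) (atin ?A z)" for p
      by simp
    then show "limitin k_WOT ?g (?g z) (atin ?A z)"
    proof (rule limitin_of_tendsto_encode)
      show "\<forall>\<^sub>F w in atin ?A z. ?g w \<in> ?W" using ev by eventually_elim (rule gW)
      show "?g z \<in> ?W" using z by (intro gW) simp
    qed
  qed
  then have "continuous_map ?A (subtopology k_WOT ?W) ?g"
    using gW by (intro continuous_map_into_subtopology) auto
  then show "homeomorphic_maps (subtopology k_WOT ?W) ?A encode ?g"
    unfolding homeomorphic_maps_def using continuous_map_encode g gW by auto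
qed

text \<open>Convergence of the cut-off entries makes all matrix coefficients converge pointwise. Their
  limits are bounded forms, hence given by contractions \<open>T t\<close>, and \<open>T\<close> is weakly continuous because
  near each point its entries are quotients of limit functions by a positive bump.\<close>

lemma limit_of_encodings:
  assumes W: "\<And>a. f a \<in> weak_contraction_maps"
    and lim: "\<And>p. (\<lambda>a. encode (f a) p) \<longlonglongrightarrow> G p"
  shows "G \<in> encode ` weak_contraction_maps"
proof -
  have ev: "(\<lambda>a. \<phi> n t * inner (f a t (d i)) (d j)) \<longlonglongrightarrow> G (n, i, j) t" for n t i j
    using tendsto_uniform_limitI [OF tendsto_bcontfun_uniform_limit [OF lim [of "(n, i, j)"]], of t]
    by (simp add: apply_encode W)
  have entry: "Cauchy (\<lambda>a. inner (f a t (d i)) (d j))" for t i j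
  proof -
    obtain n where n: "1/2 < \<phi> n t" using bumps_cover by blast
    have "(\<lambda>a. (\<phi> n t * inner (f a t (d i)) (d j)) / \<phi> n t) \<longlonglongrightarrow> G (n, i, j) t / \<phi> n t"
      using n by (intro tendsto_divide ev tendsto_const) auto
    then show ?thesis
      using n by (auto intro: LIMSEQ_imp_Cauchy)
  qed
  have "Cauchy (\<lambda>a. inner (f a t x) y)" for t x y
  proof (rule metric_CauchyI)
    fix e :: real assume "0 < e"
    then have "0 < e / 2" by simp
    obtain i j where ij: "\<And>A. norm A \<le> 2 \<Longrightarrow>
        \<bar>inner (blinfun_apply A x) y\<bar> \<le> \<bar>inner (blinfun_apply A (d i)) (d j)\<bar> + e / 2"
      using matrix_entry_approximation [OF \<open>0 < e / 2\<close>, of x y] by blast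
    obtain M where M: "\<And>a b. M \<le> a \<Longrightarrow> M \<le> b \<Longrightarrow>
        dist (inner (f a t (d i)) (d j)) (inner (f b t (d i)) (d j)) < e / 2"
      using metric_CauchyD [OF entry \<open>0 < e / 2\<close>] by blast
    have "dist (inner (f a t x) y) (inner (f b t x) y) < e" if "M \<le> a" "M \<le> b" for a b
      using ij [OF norm_diff_le_2 [OF W W], of a t b t] M [OF that]
      by (simp add: dist_real_def blinfun.diff_left inner_diff_left)
    then show "\<exists>M. \<forall>a\<ge>M. \<forall>b\<ge>M. dist (inner (f a t x) y) (inner (f b t x) y) < e"
      by blast
  qed
  then have "\<exists>l. (\<lambda>a. inner (f a t x) y) \<longlonglongrightarrow> l" for t x y
    by (simp add: Cauchy_convergent_iff convergent_def)
  then obtain b where b: "\<And>t x y. (\<lambda>a. inner (f a t x) y) \<longlonglongrightarrow> b t x y"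
    by metis
  have bound: "\<bar>b t x y\<bar> \<le> norm x * norm y" for t x y
    by (rule LIMSEQ_le_const2 [OF tendsto_rabs [OF b]])
      (auto intro: contraction_inner_bound weak_contraction_maps_norm W)
  have "\<exists>A::'h \<Rightarrow>\<^sub>L 'h. norm A \<le> 1 \<and> (\<forall>x y. inner (blinfun_apply A x) y = b t x y)" for t
  proof -
    have "bounded_bilinear (b t)"
    proof
      show "b t (x + x') y = b t x y + b t x' y" for x x' y
        using tendsto_add [OF b [of t x y] b [of t x' y]]
        by (intro LIMSEQ_unique [OF b]) (simp add: blinfun.add_right inner_add_left)
      show "b t x (y + y') = b t x y + b t x y'" for x y y'
        using tendsto_add [OF b [of t x y] b [of t x y']]
        by (intro LIMSEQ_unique [OF b]) (simp add: inner_add_right)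
      show "b t (r *\<^sub>R x) y = r *\<^sub>R b t x y" for r x y
        using tendsto_mult [OF tendsto_const b [of t x y]]
        by (intro LIMSEQ_unique [OF b]) (simp add: blinfun.scaleR_right)
      show "b t x (r *\<^sub>R y) = r *\<^sub>R b t x y" for r x y
        using tendsto_mult [OF tendsto_const b [of t x y]]
        by (intro LIMSEQ_unique [OF b]) simp
      show "\<exists>K. \<forall>x y. norm (b t x y) \<le> norm x * norm y * K"
        using bound by (intro exI [of _ 1]) simp
    qed
    then show ?thesis
      by (rule bounded_form_imp_operator [OF _ bound]) blast
  qed
  then have "\<exists>T::'m \<Rightarrow> 'h \<Rightarrow>\<^sub>L 'h. \<forall>t. norm (T t) \<le> 1 \<and> (\<forall>x y. inner (blinfun_apply (T t) x) y = b t x y)"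
    by (intro choice allI)
  then obtain T :: "'m \<Rightarrow> 'h \<Rightarrow>\<^sub>L 'h" where
    T: "\<And>t. norm (T t) \<le> 1" "\<And>t x y. inner (T t x) y = b t x y"
    by blast
  have entries: "\<phi> n t * inner (T t (d i)) (d j) = G (n, i, j) t" for n t i j
    using tendsto_mult [OF tendsto_const b] by (intro LIMSEQ_unique [OF _ ev]) (simp add: T(2))
  have "T t (c *\<^sub>C x) = c *\<^sub>C T t x" for t c x
  proof (rule vector_eq_rdot [THEN iffD1, rule_format])
    fix y
    have "(\<lambda>a. inner (f a t (c *\<^sub>C x)) y) \<longlonglongrightarrow> inner (T t x) (cnj c *\<^sub>C y)"
      unfolding weak_contraction_maps_scaleC [OF W] inner_scaleC_left T(2) by (rule b)
    then show "inner (T t (c *\<^sub>C x)) y = inner (c *\<^sub>C T t x) y"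
      unfolding inner_scaleC_left T(2) by (rule LIMSEQ_unique [OF b])
  qed
  then have contr: "range T \<subseteq> contractions"
    by (auto simp: contractions_def bounded_operators_def T(1))
  have entry_cont: "((\<lambda>s. inner (T s (d i)) (d j)) \<longlongrightarrow> inner (T t (d i)) (d j)) (at t)" for t i j
  proof -
    obtain n where n: "1/2 < \<phi> n t" using bumps_cover by blast
    have \<phi>: "(\<phi> n \<longlongrightarrow> \<phi> n t) (at t)"
      using bump_continuous by (simp add: continuous_on_def)
    have "(apply_bcontfun (G (n, i, j)) \<longlongrightarrow> G (n, i, j) t) (at t)"
      using continuous_on_apply_bcontfun [of UNIV "G (n, i, j)"] by (simp add: continuous_on_def)
    then have "((\<lambda>s. G (n, i, j) s / \<phi> n s) \<longlongrightarrow> G (n, i, j) t / \<phi> n t) (at t)"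
      using \<phi> n by (intro tendsto_divide) auto
    moreover have "\<forall>\<^sub>F s in at t. G (n, i, j) s / \<phi> n s = inner (T s (d i)) (d j)"
      using order_tendstoD(1) [OF \<phi> n] by eventually_elim (simp flip: entries)
    moreover have "G (n, i, j) t / \<phi> n t = inner (T t (d i)) (d j)"
      using n by (simp flip: entries)
    ultimately show ?thesis
      by (simp add: tendsto_cong)
  qed
  have "((\<lambda>s. inner (T s x) y) \<longlongrightarrow> inner (T t x) y) (at t)" for t x y
  proof (rule tendstoI)
    fix e :: real assume "0 < e"
    then have "0 < e / 2" by simp
    obtain i j where ij: "\<And>A. norm A \<le> 2 \<Longrightarrow>
        \<bar>inner (blinfun_apply A x) y\<bar> \<le> \<bar>inner (blinfun_apply A (d i)) (d j)\<bar> + e / 2"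
      using matrix_entry_approximation [OF \<open>0 < e / 2\<close>, of x y] by blast
    have "\<forall>\<^sub>F s in at t. dist (inner (T s (d i)) (d j)) (inner (T t (d i)) (d j)) < e / 2"
      using tendstoD [OF entry_cont \<open>0 < e / 2\<close>] .
    then show "\<forall>\<^sub>F s in at t. dist (inner (T s x) y) (inner (T t x) y) < e"
    proof eventually_elim
      case (elim s)
      have "norm (T s - T t) \<le> 2"
        using norm_triangle_ineq4 [of "T s" "T t"] T(1) [of s] T(1) [of t] by linarith
      from ij [OF this] elim show ?case
        by (simp add: dist_real_def blinfun.diff_left inner_diff_left)
    qed
  qed
  then have TW: "T \<in> weak_contraction_maps"
    unfolding weak_contraction_maps_def continuous_map_weak_operator_topology_iff_inner
    using contr by (simp add: continuous_on_def)
  have "encode T (n, i, j) = G (n, i, j)" for n i j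
    by (rule bcontfun_eqI) (simp add: apply_encode TW entries)
  then have "encode T = G" by auto
  with TW show ?thesis by blast
qed

lemma closed_encode: "closed (encode ` weak_contraction_maps)"
  unfolding closed_sequential_limits
proof (intro allI impI, elim conjE)
  fix z G assume z: "\<forall>a. z a \<in> encode ` weak_contraction_maps" and lim: "z \<longlonglongrightarrow> G"
  then have "\<forall>a. \<exists>T. T \<in> weak_contraction_maps \<and> z a = encode T"
    by blast
  then have "\<exists>f. \<forall>a. f a \<in> weak_contraction_maps \<and> z a = encode (f a)"
    by (rule choice)
  then obtain f where f: "\<And>a. f a \<in> weak_contraction_maps" "\<And>a. z a = encode (f a)"
    by blast
  have "(\<lambda>a. encode (f a) p) \<longlonglongrightarrow> G p" for p
    using lim unfolding tendsto_fun_iff f(2) by blast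
  then show "G \<in> encode ` weak_contraction_maps"
    by (rule limit_of_encodings [OF f(1)])
qed

lemma completely_metrizable_weak_contraction_maps:
  "completely_metrizable_space (subtopology k_WOT weak_contraction_maps :: ('m \<Rightarrow> 'h \<Rightarrow>\<^sub>L 'h) topology)"
  unfolding homeomorphic_completely_metrizable_space [OF homeomorphic_space_encode]
  by (rule completely_metrizable_space_closedin [OF completely_metrizable_space_euclidean])
    (rule iffD1 [OF closed_closedin closed_encode])

text \<open>The coordinate with index \<open>(n, i, j)\<close> of any encoding is supported on \<open>K n\<close>, so that it lies
  in a separable set of functions.\<close>

lemma second_countable_weak_contraction_maps:
  assumes "second_countable (euclidean :: 'm topology)"
  shows "second_countable (subtopology k_WOT weak_contraction_maps :: ('m \<Rightarrow> 'h \<Rightarrow>\<^sub>L 'h) topology)"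
proof -
  have "\<exists>Q. countable Q \<and> (\<forall>g e. (\<forall>x. x \<notin> K n \<longrightarrow> apply_bcontfun g x = (0::real)) \<longrightarrow> 0 < e \<longrightarrow>
      (\<exists>q\<in>Q. dist g q < e))" for n
    by (rule separable_bcontfun_supported_on_compact [OF assms compact_support [of n]]) blast
  then have "\<exists>Q. \<forall>n. countable (Q n) \<and> (\<forall>g e. (\<forall>x. x \<notin> K n \<longrightarrow> apply_bcontfun g x = (0::real)) \<longrightarrow>
      0 < e \<longrightarrow> (\<exists>q\<in>Q n. dist g q < e))"
    by (intro choice allI)
  then obtain Q where Q: "\<forall>n. countable (Q n) \<and> (\<forall>g e. (\<forall>x. x \<notin> K n \<longrightarrow> apply_bcontfun g x = (0::real)) \<longrightarrow>
      0 < e \<longrightarrow> (\<exists>q\<in>Q n. dist g q < e))" ..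
  have "second_countable (top_of_set (encode ` weak_contraction_maps))"
  proof (rule second_countable_product_subset [where Q = "\<lambda>p. Q (fst p)"])
    fix z p and e :: real assume "z \<in> encode ` weak_contraction_maps" "0 < e"
    then have "x \<notin> K (fst p) \<Longrightarrow> z p x = 0" for x
      by (cases p) (auto simp: apply_encode bump_support)
    with Q \<open>0 < e\<close> show "\<exists>q\<in>Q (fst p). dist (z p) q < e"
      by simp
  qed (use Q in simp)
  then show ?thesis
    by (simp only: homeomorphic_space_second_countability [OF homeomorphic_space_encode])
qed

end

section \<open>The semigroups form a countable intersection of open sets\<close>

text \<open>Multiplication of operators is only separately continuous for the weak topology. This is
  enough to extend the semigroup law from a dense set, one variable at a time.\<close>

lemma composition_on_dense_subset:
  fixes T :: "'m::topological_monoid_mult \<Rightarrow> 'h::complex_hilbert \<Rightarrow>\<^sub>L 'h"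
  assumes T: "T \<in> weak_contraction_maps" and D: "closure D = UNIV"
    and eq: "\<And>s t. s \<in> D \<Longrightarrow> t \<in> D \<Longrightarrow> T (s * t) = T s o\<^sub>L T t"
  shows "T (s * t) = T s o\<^sub>L T t"
proof -
  have cont: "continuous_on UNIV (\<lambda>r. inner (T (f r) x) y)" if "continuous_on UNIV f"
    for f :: "'m \<Rightarrow> 'm" and x y
    by (rule continuous_on_compose2 [OF weak_contraction_maps_continuous [OF T] that]) simp
  have extend: "f r = g r"
    if "continuous_on UNIV f" "continuous_on UNIV g" "\<And>r. r \<in> D \<Longrightarrow> f r = g r"
    for f g :: "'m \<Rightarrow> real" and r
  proof -
    have "closure D \<subseteq> {r. f r = g r}"
      using that by (intro closure_minimal closed_Collect_eq) auto
    with D show ?thesis by auto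
  qed
  \<comment> \<open>The product \<open>T s o\<^sub>L T t\<close> is weakly continuous in each variable separately:
    in \<open>t\<close> because \<open>T s\<close> has an adjoint.\<close>
  have right: "inner (T (s * t) x) y = inner (T s (T t x)) y" if "s \<in> D" for s t x y
  proof -
    obtain B where B: "\<And>x y. inner (T s x) y = inner x (B y)"
      by (rule adjoint_exists [of "T s"]) blast
    show ?thesis
    proof (rule extend [of "\<lambda>t. inner (T (s * t) x) y" "\<lambda>t. inner (T s (T t x)) y"])
      show "continuous_on UNIV (\<lambda>t. inner (T (s * t) x) y)"
        by (rule cont) (intro continuous_on_mult' continuous_on_const continuous_on_id)
      show "continuous_on UNIV (\<lambda>t. inner (T s (T t x)) y)"
        unfolding B by (rule weak_contraction_maps_continuous [OF T])
    qed (simp add: eq that)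
  qed
  have "inner (T (s * t) x) y = inner (T s (T t x)) y" for x y
  proof (rule extend [of "\<lambda>s. inner (T (s * t) x) y" "\<lambda>s. inner (T s (T t x)) y"])
    show "continuous_on UNIV (\<lambda>s. inner (T (s * t) x) y)"
      by (rule cont) (intro continuous_on_mult' continuous_on_const continuous_on_id)
    show "continuous_on UNIV (\<lambda>s. inner (T s (T t x)) y)"
      by (rule weak_contraction_maps_continuous [OF T])
  qed (rule right)
  then show ?thesis
    by (intro blinfun_eqI vector_eq_rdot [THEN iffD1]) simp
qed

context dense_sequence
begin

text \<open>With \<open>B\<close> the adjoint of \<open>T s\<close>, the coefficient of the product is \<open>inner (T t x) (B y)\<close>, which
  by polarization is a quarter of the difference of the squared norms of \<open>T t x + B y\<close> and
  \<open>T t x - B y\<close>. Each norm is a limit of maxima of functions that are continuous in \<open>T\<close>,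
  because \<open>inner (B y) u = inner (T s u) y\<close>. Hence the coefficient is a pointwise limit of
  continuous functions of \<open>T\<close>, and its agreement with the continuous coefficient of \<open>T (s * t)\<close> is
  a \<open>G\<^sub>\<delta>\<close> condition.\<close>

lemma gdelta_in_composition:
  fixes s t :: "'m::topological_monoid_mult"
  defines "X \<equiv> subtopology k_WOT weak_contraction_maps :: ('m \<Rightarrow> 'h \<Rightarrow>\<^sub>L 'h) topology"
  shows "gdelta_in X {T \<in> topspace X. inner (T s (T t x)) y - inner (T (s * t) x) y = 0}"
proof (rule gdelta_in_zeros_of_pointwise_limit)
  let ?u = "\<lambda>k. sgn (d k)"
  let ?p = "\<lambda>n T. MAX k\<in>{..n}. \<bar>inner (blinfun_apply (T t) x) (?u k) + inner (blinfun_apply (T s) (?u k)) y\<bar>"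
  let ?q = "\<lambda>n T. MAX k\<in>{..n}. \<bar>inner (blinfun_apply (T t) x) (?u k) - inner (blinfun_apply (T s) (?u k)) y\<bar>"
  let ?h = "\<lambda>n T. ((?p n T)\<^sup>2 - (?q n T)\<^sup>2) / 4 - inner (blinfun_apply (T (s * t)) x) y"
  have eval: "continuous_map X euclideanreal (\<lambda>T. inner (blinfun_apply (T r) v) w)" for r v w
    unfolding X_def by (rule continuous_map_weak_evaluation)
  show "continuous_map X euclideanreal (?h n)" for n
    by (intro continuous_map_diff continuous_map_real_divide continuous_map_real_pow continuous_map_Max
        continuous_map_real_abs continuous_map_add eval continuous_map_canonical_const) auto
  fix T assume "T \<in> topspace X"
  obtain B where B: "\<And>x y. inner (T s x) y = inner x (B y)"
    by (rule adjoint_exists [of "T s"]) blast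
  have "(\<lambda>n. ?p n T) \<longlonglongrightarrow> norm (T t x + B y)"
    using norm_eq_limit_Max_inner [OF dense, of "T t x + B y"]
    by (simp add: B inner_add_left inner_commute [of "B y"])
  moreover have "(\<lambda>n. ?q n T) \<longlonglongrightarrow> norm (T t x - B y)"
    using norm_eq_limit_Max_inner [OF dense, of "T t x - B y"]
    by (simp add: B inner_diff_left inner_commute [of "B y"])
  ultimately have "(\<lambda>n. ?h n T) \<longlonglongrightarrow>
      ((norm (T t x + B y))\<^sup>2 - (norm (T t x - B y))\<^sup>2) / 4 - inner (T (s * t) x) y"
    by (intro tendsto_intros) auto
  also have "((norm (T t x + B y))\<^sup>2 - (norm (T t x - B y))\<^sup>2) / 4 = inner (T s (T t x)) y"
    unfolding power2_norm_eq_inner B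
    by (simp add: inner_add inner_diff inner_commute algebra_simps)
  finally show "(\<lambda>n. ?h n T) \<longlonglongrightarrow> inner (T s (T t x)) y - inner (T (s * t) x) y" .
qed

lemma gdelta_in_C_w:
  assumes D: "countable D" "closure D = (UNIV :: 'm::topological_monoid_mult set)"
  shows "gdelta_in (subtopology k_WOT weak_contraction_maps) (C_w :: ('m \<Rightarrow> 'h \<Rightarrow>\<^sub>L 'h) set)"
proof -
  let ?X = "subtopology k_WOT weak_contraction_maps :: ('m \<Rightarrow> 'h \<Rightarrow>\<^sub>L 'h) topology"
  define Z where "Z = (\<lambda>(s, t, i, j).
      {T \<in> topspace ?X. inner (T s (T t (d i))) (d j) - inner (T (s * t) (d i)) (d j) = 0})"
  define Z1 where "Z1 = (\<lambda>(i, j). {T \<in> topspace ?X. inner (T 1 (d i)) (d j) - inner (d i) (d j) = 0})"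
  have "D \<noteq> {}" using D(2) by auto
  have "gdelta_in ?X (Z p)" for p
    unfolding Z_def by (cases p) (simp only: case_prod_conv, rule gdelta_in_composition)
  then have "gdelta_in ?X (\<Inter>(Z ` (D \<times> D \<times> UNIV \<times> UNIV)))"
    using D(1) \<open>D \<noteq> {}\<close> by (intro gdelta_in_Inter) auto
  moreover have "gdelta_in ?X (Z1 p)" for p
    unfolding Z1_def case_prod_unfold
    by (rule gdelta_in_zeros_of_pointwise_limit [OF _ tendsto_const])
      (intro continuous_map_diff continuous_map_weak_evaluation continuous_map_canonical_const)
  then have "gdelta_in ?X (\<Inter>(Z1 ` UNIV))"
    by (intro gdelta_in_Inter) auto
  ultimately have "gdelta_in ?X (\<Inter>(Z ` (D \<times> D \<times> UNIV \<times> UNIV)) \<inter> \<Inter>(Z1 ` UNIV))"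
    by (rule gdelta_in_Int)
  moreover have "\<Inter>(Z ` (D \<times> D \<times> UNIV \<times> UNIV)) \<inter> \<Inter>(Z1 ` UNIV) = C_w"
  proof (intro equalityI subsetI)
    fix T assume T: "T \<in> \<Inter>(Z ` (D \<times> D \<times> UNIV \<times> UNIV)) \<inter> \<Inter>(Z1 ` UNIV)"
    then have W: "T \<in> weak_contraction_maps" by (auto simp: Z1_def)
    have norm: "norm (T t) \<le> 1" for t using W by (rule weak_contraction_maps_norm)
    have one: "T 1 = id_blinfun"
    proof (rule blinfun_eqI_entries)
      fix i j
      have "T \<in> Z1 (i, j)" using T by blast
      then show "inner (T 1 (d i)) (d j) = inner (id_blinfun (d i)) (d j)"
        by (simp add: Z1_def)
    qed (auto simp: norm intro: norm_blinfun_id_le)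
    have "T (s * t) = T s o\<^sub>L T t" if "s \<in> D" "t \<in> D" for s t
    proof (rule blinfun_eqI_entries)
      fix i j
      have "T \<in> Z (s, t, i, j)" using T that by blast
      then show "inner (T (s * t) (d i)) (d j) = inner ((T s o\<^sub>L T t) (d i)) (d j)"
        by (simp add: Z_def)
      have "norm (T s o\<^sub>L T t) \<le> norm (T s) * norm (T t)" by (rule norm_blinfun_compose)
      also have "\<dots> \<le> 1" by (intro mult_le_one norm norm_ge_zero)
      finally show "norm (T s o\<^sub>L T t) \<le> 1" .
    qed (rule norm)
    then have "T (s * t) = T s o\<^sub>L T t" for s t
      by (rule composition_on_dense_subset [OF W D(2)])
    with W one show "T \<in> C_w"
      by (auto simp: weak_contraction_maps_def C_w_def contractive_semigroup_def
          operator_semigroup_def contractions_def)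
  next
    fix T :: "'m \<Rightarrow> 'h \<Rightarrow>\<^sub>L 'h" assume "T \<in> C_w"
    then have "T \<in> weak_contraction_maps" "T 1 = id_blinfun" "\<And>s t. T (s * t) = T s o\<^sub>L T t"
      by (auto simp: weak_contraction_maps_def C_w_def contractive_semigroup_def
          operator_semigroup_def)
    then show "T \<in> \<Inter>(Z ` (D \<times> D \<times> UNIV \<times> UNIV)) \<inter> \<Inter>(Z1 ` UNIV)"
      by (simp add: Z_def Z1_def)
  qed
  ultimately show ?thesis by simp
qed

end

section \<open>The space of semigroups is Polish\<close>

lemma separable_space_euclideanD:
  assumes "separable_space (euclidean :: 'a::topological_space topology)"
  obtains C where "countable C" "closure C = (UNIV :: 'a::topological_space set)"
proof -
  obtain C :: "'a set" where "countable C" "euclidean closure_of C = UNIV"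
    using assms unfolding separable_space_def topspace_euclidean by blast
  then show thesis
    by (intro that [of C]) simp_all
qed

lemma polish_C_w:
  assumes sep: "separable_space (euclidean :: 'h::complex_hilbert topology)"
    and lc: "locally_compact_space (euclidean :: 'm::topological_monoid_mult topology)"
    and pol: "polish_topology (euclidean :: 'm topology)"
  shows "polish_topology (subtopology k_WOT (C_w :: ('m \<Rightarrow> 'h \<Rightarrow>\<^sub>L 'h) set))"
proof -
  obtain C where C: "countable C" "closure C = (UNIV :: 'h set)"
    using sep by (rule separable_space_euclideanD)
  then have "C \<noteq> {}" by auto
  define d where "d = from_nat_into C"
  interpret dense_sequence d
  proof
    fix e :: real and x :: 'h assume "0 < e"
    then obtain c where "c \<in> C" "dist c x < e"
      using C(2) closure_approachable [of x C] by auto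
    then show "\<exists>n. norm (x - d n) < e"
      unfolding d_def
      by (intro exI [of _ "to_nat_on C c"]) (simp add: C(1) dist_commute flip: dist_norm)
  qed
  obtain \<phi> :: "nat \<Rightarrow> 'm \<Rightarrow> real" and K where
    "\<And>n. continuous_on UNIV (\<phi> n)" "\<And>n x. \<bar>\<phi> n x\<bar> \<le> 1"
    "\<And>n. compact (K n)" "\<And>n x. x \<notin> K n \<Longrightarrow> \<phi> n x = 0" "\<And>x. \<exists>n. 1/2 < \<phi> n x"
    using lc pol by (rule bump_functions) blast
  then interpret weak_encoding d \<phi> K
    by unfold_locales
  have "separable_space (euclidean :: 'm topology)"
    using pol by (simp add: polish_topology_def)
  then obtain D where D: "countable D" "closure D = (UNIV :: 'm set)"
    by (rule separable_space_euclideanD)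
  let ?X = "subtopology k_WOT weak_contraction_maps :: ('m \<Rightarrow> 'h \<Rightarrow>\<^sub>L 'h) topology"
  have gd: "gdelta_in ?X C_w" using D by (rule gdelta_in_C_w)
  have sub: "(C_w :: ('m \<Rightarrow> 'h \<Rightarrow>\<^sub>L 'h) set) \<subseteq> weak_contraction_maps"
    using gdelta_in_subset [OF gd] by simp
  have "subtopology ?X C_w = subtopology k_WOT C_w"
    using sub by (simp add: subtopology_subtopology Int_absorb1)
  moreover have "completely_metrizable_space (subtopology ?X C_w)"
    using completely_metrizable_weak_contraction_maps gd
    by (rule completely_metrizable_space_gdelta_in)
  moreover have "separable_space (subtopology ?X C_w)"
    by (intro second_countable_imp_separable_space second_countable_subtopology
        second_countable_weak_contraction_maps polish_imp_second_countable pol)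
  ultimately show ?thesis
    by (simp add: polish_topology_def)
qed

theorem theorem4p1:
  assumes "separable_space (euclidean :: 'h::complex_hilbert topology)"
    and "infinite_dimensional TYPE('h)"
    and "locally_compact_space (euclidean :: 'm::topological_monoid_mult topology)"
    and "polish_topology (euclidean :: 'm topology)"
    and "good_monoid TYPE('m) TYPE('h)"
  shows "polish_topology (subtopology k_WOT (C_s :: ('m \<Rightarrow> 'h \<Rightarrow>\<^sub>L 'h) set))"
proof -
  have "C_w = (C_s :: ('m \<Rightarrow> 'h \<Rightarrow>\<^sub>L 'h) set)"
    using assms(5) unfolding good_monoid_def .
  with polish_C_w [OF assms(1,3,4)] show ?thesis by simp
qed

end
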